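(* Fix $\varepsilon>0$. Let $p=p(n)\in(0,1)$ and positive integers $\tau=\tau(n)$ satisfy $np\geq n^{1/2+\varepsilon}$, $p\to0$ as $n\to\infty$, and $1\leq\tau\leq n^{\varepsilon}$. Then there exist $c>0$ and $n_0$ such that for all $n\geq n_0$, $$\mathbb{P}\left(\frac{\varepsilon}{10}\cdot\frac{\tau\ln n}{p}\leq\mathsf{c}^{\max}_{\tau}(G_{n,p})\leq10\cdot\frac{\tau\ln n}{p}\right)\geq1-e^{-c\sqrt{n}}.$$
   Context: $G_{n,p}$ is the binomial random graph on $n$ vertices, each of the $\binom n2$ possible edges present independently with probability $p$. A multi-layer graph with designated layers is $(V,\{C_1,\dots,C_\tau\},R)$ with cop layers $C_i\subseteq\binom V2$ and robber layer $R\subseteq\binom V2$; $(V,\{C_1,\dots,C_\tau\},* )$ means $R=C_1\cup\dots\cup C_\tau$. Game with allocation $(k_1,\dots,k_\tau)$: $k_i$ cops assigned to layer $C_i$; cops placed first, then the robber; turns alternate starting with the cops; each cop stays or moves along one edge of its own layer, the robber stays or moves along one edge of $R$; cops win if a cop ever occupies the robber's vertex. The multi-layer cop number $\mathsf c(\mathcal G)$ is the least $k$ such that some allocation with $\sum_ik_i=k$ gives the cop player a winning strategy. For a simple graph $G=(V,E)$ and integer $\tau\geq1$, let $\mathcal{L}(G,\tau)$ be the set of all multi-layer graphs $(V,\{C_1,\dots,C_\tau\},* )$ with $C_1\cup\dots\cup C_\tau=E$ and each simple graph $(V,C_i)$ connected (layers may share edges). The extremal multi-layer cop number is $\mathsf{c}^{\max}_\tau(G)=\max_{\mathcal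 G\in\mathcal L(G,\tau)}\mathsf c(\mathcal G)$, with the convention that it equals $0$ when $\mathcal L(G,\tau)$ is empty (i.e. when $G$ is disconnected). *)

theory Defs
  imports "HOL-Probability.Probability"
begin

section \<open>The binomial random graph\<close>

text \<open>A simple graph is given by its vertex set and its set of edges, each edge being a set of
  two vertices.\<close>

definition all_edges :: "'a set \<Rightarrow> 'a set set" where
  "all_edges V = {e. e \<subseteq> V \<and> card e = 2}"

definition binomial_graph :: "nat \<Rightarrow> real \<Rightarrow> nat set set pmf" where
  "binomial_graph n p =
     map_pmf (\<lambda>present. {e \<in> all_edges {..<n}. present e})
       (Pi_pmf (all_edges {..<n}) False (\<lambda>_. bernoulli_pmf p))"

definition connected_graph :: "'a set \<Rightarrow> 'a set set \<Rightarrow> bool" where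
  "connected_graph V E \<longleftrightarrow> (\<forall>u\<in>V. \<forall>v\<in>V. (u, v) \<in> {(x, y). {x, y} \<in> E}\<^sup>*)"


section \<open>Multi-layer graphs and the cops and robber game\<close>

text \<open>The cop layers form an indexed family, so the same edge set may occur as several layers.\<close>

record 'a multilayer_graph =
  vertices :: "'a set"
  cop_layers :: "'a set set list"
  robber_layer :: "'a set set"

definition step_along :: "'a set set \<Rightarrow> 'a \<Rightarrow> 'a \<Rightarrow> bool" where
  "step_along E u v \<longleftrightarrow> v = u \<or> {u, v} \<in> E"

text \<open>For an allocation \<open>ks\<close>, the pair \<open>(i, j)\<close> is the \<open>j\<close>-th cop assigned to layer \<open>i\<close>.\<close>

definition cops :: "nat list \<Rightarrow> (nat \<times> nat) set" where
  "cops ks = {(i, j). i < length ks \<and> j < ks ! i}"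

text \<open>A cop strategy maps the list of all robber positions seen so far to the current cop
  positions: \<open>\<sigma> []\<close> is the initial placement, and \<open>\<sigma> [r\<^sub>0, \<dots>, r\<^sub>t]\<close> is the position after the
  cops have answered the robber's position \<open>r\<^sub>t\<close>.\<close>

definition cop_strategy ::
  "'a multilayer_graph \<Rightarrow> nat list \<Rightarrow> ('a list \<Rightarrow> nat \<times> nat \<Rightarrow> 'a) \<Rightarrow> bool" where
  "cop_strategy G ks \<sigma> \<longleftrightarrow>
     (\<forall>(i, j) \<in> cops ks. \<sigma> [] (i, j) \<in> vertices G \<and>
        (\<forall>rs r. step_along (cop_layers G ! i) (\<sigma> rs (i, j)) (\<sigma> (rs @ [r]) (i, j))))"

definition robber_play :: "'a multilayer_graph \<Rightarrow> (nat \<Rightarrow> 'a) \<Rightarrow> bool" where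
  "robber_play G r \<longleftrightarrow>
     r 0 \<in> vertices G \<and> (\<forall>t. step_along (robber_layer G) (r t) (r (Suc t)))"

text \<open>The robber may be caught at \<open>r t\<close> either by stepping onto (or starting at) a vertex
  occupied by a cop, or by the next move of the cops.\<close>

definition captures :: "nat list \<Rightarrow> ('a list \<Rightarrow> nat \<times> nat \<Rightarrow> 'a) \<Rightarrow> (nat \<Rightarrow> 'a) \<Rightarrow> bool" where
  "captures ks \<sigma> r \<longleftrightarrow>
     (\<exists>t. \<exists>c \<in> cops ks. \<sigma> (map r [0..<t]) c = r t \<or> \<sigma> (map r [0..<Suc t]) c = r t)"

definition cops_win :: "'a multilayer_graph \<Rightarrow> nat list \<Rightarrow> bool" where
  "cops_win G ks \<longleftrightarrow>
     (\<exists>\<sigma>. cop_strategy G ks \<sigma> \<and> (\<forall>r. robber_play G r \<longrightarrow> captures ks \<sigma> r))"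

definition multilayer_cop_number :: "'a multilayer_graph \<Rightarrow> nat" where
  "multilayer_cop_number G =
     (LEAST k. \<exists>ks. length ks = length (cop_layers G) \<and> sum_list ks = k \<and> cops_win G ks)"


section \<open>The extremal multi-layer cop number\<close>

definition layerings :: "'a set \<Rightarrow> 'a set set \<Rightarrow> nat \<Rightarrow> 'a multilayer_graph set" where
  "layerings V E \<tau> =
     {\<lparr>vertices = V, cop_layers = Cs, robber_layer = \<Union>(set Cs)\<rparr> | Cs.
        length Cs = \<tau> \<and> \<Union>(set Cs) = E \<and> (\<forall>C \<in> set Cs. connected_graph V C)}"

text \<open>For finite \<open>V\<close> and \<open>E\<close> there are only finitely many layerings, so the maximum exists
  whenever there is a layering at all.\<close>

definition max_cop_number :: "'a set \<Rightarrow> 'a set set \<Rightarrow> nat \<Rightarrow> nat" where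
  "max_cop_number V E \<tau> =
     (if layerings V E \<tau> = {} then 0 else Max (multilayer_cop_number ` layerings V E \<tau>))"

end

(* Upper bound: all degrees are at least np/4 with high probability, so picking vertices greedily
   gives a set of fewer than 5 ln n / p vertices adjacent to everything; one cop per layer on each of
   them catches the robber in the first move, for every layering.

   Lower bound: give each edge a uniformly random layer. Each layer is then a binomial random graph
   with edge probability p/tau >= n^(-1/2), which has no empty cut and so is connected. For a robber
   at v and K cops at given vertices, a further vertex u is a neighbour of v that no cop can enter
   with probability at least p exp(-2pK/tau), independently for distinct u. With
   K <= (eps/10) tau ln n / p some such u exists except with probability
   exp(-n^(1/2 + 4 eps/5)/2), which beats the number exp(O(sqrt n (ln n)^2)) of positions. So the
   robber escapes from every position. *)

theory Submission
  imports Defs "HOL-Real_Asymp.Real_Asymp"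
begin

section \<open>The game\<close>

text \<open>Cops may react to the robber, and a union bound over their strategies is hopeless. The
  robber therefore gets a criterion on single positions, \<open>evasive\<close>, which no longer
  mentions plays; positions are few enough for a union bound. One random labelling carries both the
  graph and a layering of it. Its graph marginal is \<open>binomial_graph n p\<close>, and the
  maximum over layerings asks for a single good layering, so the probability of a good labelling
  bounds that of a good graph from below, without conditioning on the graph. The hypotheses on
  \<open>p\<close> and \<open>\<tau>\<close> are combined into
  \<open>\<tau> * sqrt n \<le> n * p\<close>, which controls the degrees, the density of each layer
  and, through \<open>K \<le> sqrt n * ln n\<close>, the number of positions. The constant
  \<open>\<epsilon> / 10\<close> enters the escape probability through a factor
  \<open>exp (- 2 * p * K / \<tau>)\<close>, which is at least
  \<open>n powr (- \<epsilon> / 5)\<close>; the slack \<open>\<epsilon>\<close> in the hypothesis on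
  \<open>n * p\<close> pays for this factor and still leaves an exponent above
  \<open>1 / 2\<close>.\<close>

lemma finite_all_edges: "finite V \<Longrightarrow> finite (all_edges V)"
  unfolding all_edges_def by (rule finite_subset[of _ "Pow V"]) auto

lemma finite_layerings:
  assumes "finite E"
  shows "finite (layerings V E \<tau>)"
proof -
  have "layerings V E \<tau> \<subseteq> (\<lambda>Cs. \<lparr>vertices = V, cop_layers = Cs, robber_layer = \<Union>(set Cs)\<rparr>) `
      {Cs. set Cs \<subseteq> Pow E \<and> length Cs = \<tau>}"
    unfolding layerings_def by auto
  then show ?thesis
    by (rule finite_subset) (intro finite_imageI finite_lists_length_eq, use assms in auto)
qed

lemma finite_cops: "finite (cops ks)"
proof -
  have "cops ks = Sigma {..<length ks} (\<lambda>i. {..<ks ! i})"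
    unfolding cops_def by auto
  then show ?thesis by simp
qed

lemma card_cops: "card (cops ks) = sum_list ks"
proof -
  have "cops ks = Sigma {..<length ks} (\<lambda>i. {..<ks ! i})"
    unfolding cops_def by auto
  then show ?thesis
    by (simp add: sum_list_sum_nth atLeast0LessThan)
qed

text \<open>A total dominating set: vertices of \<open>D\<close> need a neighbour in
  \<open>D\<close> as well. The greedy choice from degree bounds yields this form directly, since it
  counts neighbours only.\<close>

definition dominating :: "'a set \<Rightarrow> 'a set set \<Rightarrow> 'a set \<Rightarrow> bool" where
  "dominating V E D \<longleftrightarrow> D \<subseteq> V \<and> (\<forall>v\<in>V. \<exists>d\<in>D. {d, v} \<in> E)"

text \<open>Each vertex of a dominating set gets one cop in every layer: whichever layer contains the edge
  from the set to the robber's initial position, some cop can use it at once.\<close>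

lemma cops_win_of_dominating:
  assumes G: "G \<in> layerings V E \<tau>" and D: "dominating V E D" "finite D"
  shows "cops_win G (replicate \<tau> (card D))"
proof -
  obtain Cs where Cs: "G = \<lparr>vertices = V, cop_layers = Cs, robber_layer = \<Union>(set Cs)\<rparr>"
      "length Cs = \<tau>" "\<Union>(set Cs) = E"
    using G unfolding layerings_def by auto
  obtain h where h: "bij_betw h {0..<card D} D"
    using ex_bij_betw_nat_finite[OF D(2)] by blast
  let ?ks = "replicate \<tau> (card D)"
  \<comment> \<open>Only the robber's first vertex \<open>hd rs\<close> matters. A cop whose layer
    joins its base to that vertex goes there and stays, all others never move, so the strategy is
    legal for every history.\<close>
  define \<sigma> where "\<sigma> rs c = (if rs \<noteq> [] \<and> {h (snd c), hd rs} \<in> Cs ! fst c then hd rs else h (snd c))"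
    for rs :: "'a list" and c :: "nat \<times> nat"
  have "cop_strategy G ?ks \<sigma>"
    unfolding cop_strategy_def
  proof (clarsimp, intro conjI allI)
    fix i j assume ij: "(i, j) \<in> cops ?ks"
    then have "j < card D" by (auto simp: cops_def)
    then have "h j \<in> D" using h by (auto simp: bij_betw_def)
    then show "\<sigma> [] (i, j) \<in> vertices G"
      using D(1) by (auto simp: \<sigma>_def Cs dominating_def)
    fix rs r
    show "step_along (cop_layers G ! i) (\<sigma> rs (i, j)) (\<sigma> (rs @ [r]) (i, j))"
      by (cases rs) (auto simp: \<sigma>_def step_along_def Cs)
  qed
  moreover have "captures ?ks \<sigma> r" if r: "robber_play G r" for r
  proof -
    have "r 0 \<in> V" using r by (simp add: robber_play_def Cs)
    then obtain d where d: "d \<in> D" "{d, r 0} \<in> E" using D(1) by (auto simp: dominating_def)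
    then obtain C where "C \<in> set Cs" "{d, r 0} \<in> C" using Cs by auto
    then obtain i where i: "i < \<tau>" "{d, r 0} \<in> Cs ! i" using Cs by (auto simp: in_set_conv_nth)
    obtain j where j: "j < card D" "h j = d"
      using h d(1) unfolding bij_betw_def by (metis atLeastLessThan_iff imageE)
    have "(i, j) \<in> cops ?ks" using i j by (simp add: cops_def)
    moreover have "\<sigma> (map r [0..<Suc 0]) (i, j) = r 0"
      using i j by (simp add: \<sigma>_def)
    ultimately show ?thesis unfolding captures_def by blast
  qed
  ultimately show ?thesis unfolding cops_win_def by blast
qed

lemma multilayer_cop_number_le:
  assumes "G \<in> layerings V E \<tau>" "dominating V E D" "finite D"
  shows "multilayer_cop_number G \<le> \<tau> * card D"
  unfolding multilayer_cop_number_def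
proof (rule Least_le, intro exI conjI)
  show "cops_win G (replicate \<tau> (card D))" by (rule cops_win_of_dominating[OF assms])
qed (use assms in \<open>auto simp: layerings_def sum_list_replicate\<close>)

lemma max_cop_number_le:
  assumes "finite E" "dominating V E D" "finite D"
  shows "max_cop_number V E \<tau> \<le> \<tau> * card D"
  unfolding max_cop_number_def
  using finite_layerings[OF assms(1), of V \<tau>] multilayer_cop_number_le[OF _ assms(2,3)]
  by auto

text \<open>A pair \<open>(w, i)\<close> stands for a cop of layer \<open>i\<close> at the vertex \<open>w\<close>.\<close>

definition escape_move :: "'a set set \<Rightarrow> (nat \<Rightarrow> 'a set set) \<Rightarrow> 'a \<Rightarrow> ('a \<times> nat) set \<Rightarrow> 'a \<Rightarrow> bool" where
  "escape_move E C v D u \<longleftrightarrow> {v, u} \<in> E \<and> u \<notin> fst ` D \<and> (\<forall>(w, i)\<in>D. {w, u} \<notin> C i)"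

text \<open>\<open>D\<close> is a set because cops sharing vertex and layer threaten the same
  vertices. It ranges over all distributions of at most \<open>K\<close> cops over the layers, so
  every allocation is treated at once.\<close>

definition evasive :: "'a set \<Rightarrow> 'a set set \<Rightarrow> (nat \<Rightarrow> 'a set set) \<Rightarrow> nat \<Rightarrow> nat \<Rightarrow> bool" where
  "evasive V E C \<tau> K \<longleftrightarrow> (\<forall>v\<in>V. \<forall>D. D \<subseteq> V \<times> {..<\<tau>} \<and> card D \<le> K \<and> v \<notin> fst ` D \<longrightarrow>
     (\<exists>u. escape_move E C v D u))"

text \<open>A strategy is a fixed function of the robber's history, so the robber's answers can be
  defined by recursion on that history. An escape move is safe when it is made and after the cops'
  answer, and it leads to a position to which \<open>evasive\<close> applies again.\<close>

lemma not_cops_win_of_evasive: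
  assumes V: "finite V" "K < card V" and E: "\<Union>(set Cs) \<subseteq> all_edges V"
    and ev: "evasive V (\<Union>(set Cs)) ((!) Cs) (length Cs) K"
    and ks: "length ks = length Cs" "sum_list ks \<le> K"
  shows "\<not> cops_win \<lparr>vertices = V, cop_layers = Cs, robber_layer = \<Union>(set Cs)\<rparr> ks"
proof
  let ?G = "\<lparr>vertices = V, cop_layers = Cs, robber_layer = \<Union>(set Cs)\<rparr>"
  assume "cops_win ?G ks"
  then obtain \<sigma> where \<sigma>: "cop_strategy ?G ks \<sigma>" and win: "\<And>r. robber_play ?G r \<Longrightarrow> captures ks \<sigma> r"
    unfolding cops_win_def by blast
  define D where "D rs = (\<lambda>c. (\<sigma> rs c, fst c)) ` cops ks" for rs
  have step: "step_along (Cs ! fst c) (\<sigma> rs c) (\<sigma> (rs @ [r]) c)" if "c \<in> cops ks" for c rs r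
    using \<sigma> that unfolding cop_strategy_def by (cases c) auto
  have edgeV: "w \<in> V" if "{u, w} \<in> Cs ! i" "i < length Cs" for u w i
  proof -
    have "{u, w} \<in> all_edges V" using that E nth_mem[of i Cs] by blast
    then show ?thesis by (auto simp: all_edges_def)
  qed
  have \<sigma>V: "\<sigma> rs c \<in> V" if c: "c \<in> cops ks" for rs c
  proof (induction rs rule: rev_induct)
    case Nil
    then show ?case using \<sigma> c unfolding cop_strategy_def by (cases c) auto
  next
    case (snoc r rs)
    have "fst c < length Cs" using c ks by (auto simp: cops_def)
    then show ?case using step[OF c, of rs r] snoc edgeV unfolding step_along_def by metis
  qed
  have D: "D rs \<subseteq> V \<times> {..<length Cs}" "card (D rs) \<le> K" "finite (D rs)" for rs
  proof -
    show "D rs \<subseteq> V \<times> {..<length Cs}"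
      using \<sigma>V ks by (auto simp: D_def cops_def)
    show "card (D rs) \<le> K"
      using card_image_le[OF finite_cops, of "\<lambda>c. (\<sigma> rs c, fst c)" ks] ks(2)
      unfolding D_def card_cops by linarith
    show "finite (D rs)" by (simp add: D_def finite_cops)
  qed
  have ex: "\<exists>u. escape_move (\<Union>(set Cs)) ((!) Cs) v (D rs) u" if "v \<in> V" "v \<notin> fst ` D rs" for v rs
    using ev that D unfolding evasive_def by blast
  have "card (fst ` D []) < card V"
    using card_image_le[OF D(3), of fst "[]"] D(2)[of "[]"] V by linarith
  then have "\<not> V \<subseteq> fst ` D []"
    using card_mono[of "fst ` D []" V] D(3)[of "[]"] by auto
  then obtain v0 where v0: "v0 \<in> V" "v0 \<notin> fst ` D []" by blast
  \<comment> \<open>\<open>move []\<close> is the robber's placement. It is an escape move from the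
    free vertex \<open>v0\<close>, as if the robber had stood there before the game, so the first
    answer of the cops cannot reach it.\<close>
  define move where "move rs = (SOME u. escape_move (\<Union>(set Cs)) ((!) Cs)
      (if rs = [] then v0 else last rs) (D rs) u)" for rs
  define hist where "hist t = ((\<lambda>rs. rs @ [move rs]) ^^ t) []" for t
  define r where "r t = move (hist t)" for t
  have hist: "hist t = map r [0..<t]" for t
    by (induction t) (auto simp: hist_def r_def)
  \<comment> \<open>The last two conjuncts refute the two disjuncts of \<open>captures\<close>: an
    escape move never enters an occupied vertex, and the cops' answer does not reach
    \<open>r t\<close>.\<close>
  have inv: "r t \<in> V \<and> escape_move (\<Union>(set Cs)) ((!) Cs) (if t = 0 then v0 else r (t - 1)) (D (hist t)) (r t) \<and>
      r t \<notin> fst ` D (hist (Suc t))" for t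
  proof (induction t)
    have main: "r t \<in> V \<and> escape_move (\<Union>(set Cs)) ((!) Cs) v (D (hist t)) (r t) \<and>
      r t \<notin> fst ` D (hist (Suc t))"
      if v: "v = (if hist t = [] then v0 else last (hist t))" "v \<in> V" "v \<notin> fst ` D (hist t)" for v t
    proof -
      have e: "escape_move (\<Union>(set Cs)) ((!) Cs) v (D (hist t)) (r t)"
        unfolding r_def move_def v(1)[symmetric] by (rule someI_ex[OF ex[OF v(2,3)]])
      then have "{v, r t} \<in> all_edges V" using E by (auto simp: escape_move_def)
      then have "r t \<in> V" by (auto simp: all_edges_def)
      have "r t \<noteq> \<sigma> (hist (Suc t)) c" if c: "c \<in> cops ks" for c
      proof
        assume *: "r t = \<sigma> (hist (Suc t)) c"
        have "(\<sigma> (hist t) c, fst c) \<in> D (hist t)" using c by (auto simp: D_def)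
        then have "{\<sigma> (hist t) c, r t} \<notin> Cs ! fst c" "r t \<noteq> \<sigma> (hist t) c"
          using e unfolding escape_move_def by force+
        moreover have "hist (Suc t) = hist t @ [r t]" by (simp add: hist)
        ultimately show False using step[OF c, of "hist t" "r t"] * unfolding step_along_def by metis
      qed
      then have "r t \<notin> fst ` D (hist (Suc t))" by (fastforce simp only: D_def image_image fst_conv)
      with e \<open>r t \<in> V\<close> show ?thesis by blast
    qed
    case 0
    show ?case using main[of v0 0] v0 by (simp add: hist)
    case (Suc t)
    show ?case using main[of "r t" "Suc t"] Suc by (simp add: hist)
  qed
  have "robber_play ?G r"
    unfolding robber_play_def step_along_def
  proof (intro conjI allI)
    show "r 0 \<in> vertices ?G" using inv[of 0] by simp
    show "r (Suc t) = r t \<or> {r t, r (Suc t)} \<in> robber_layer ?G" for t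
      using inv[of "Suc t"] by (auto simp: escape_move_def)
  qed
  from win[OF this] obtain t c where c: "c \<in> cops ks"
    and or: "\<sigma> (hist t) c = r t \<or> \<sigma> (hist (Suc t)) c = r t"
    unfolding captures_def hist[symmetric] by blast
  have "\<sigma> rs c \<in> fst ` D rs" for rs using c by (force simp: D_def)
  then have "r t \<in> fst ` D (hist t) \<or> r t \<in> fst ` D (hist (Suc t))" using or by metis
  then show False using inv[of t] unfolding escape_move_def by blast
qed

text \<open>\<open>LEAST\<close> says something about winning only once some allocation wins; the
  dominating set provides one. After that it suffices to rule out all allocations of at most
  \<open>K\<close> cops for this one layering.\<close>

lemma max_cop_number_gt:
  assumes V: "finite V" "K < card V" and E: "E \<subseteq> all_edges V" and Cs: "\<Union>(set Cs) = E"
    and conn: "\<And>C. C \<in> set Cs \<Longrightarrow> connected_graph V C"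
    and ev: "evasive V E ((!) Cs) (length Cs) K" and dom: "dominating V E D"
  shows "K < max_cop_number V E (length Cs)"
proof -
  let ?G = "\<lparr>vertices = V, cop_layers = Cs, robber_layer = \<Union>(set Cs)\<rparr>"
  have fin: "finite E" "finite D"
    using finite_subset[OF E finite_all_edges] V dom by (auto simp: dominating_def intro: finite_subset)
  have G: "?G \<in> layerings V E (length Cs)" using Cs conn by (auto simp: layerings_def)
  let ?P = "\<lambda>k. \<exists>ks. length ks = length (cop_layers ?G) \<and> sum_list ks = k \<and> cops_win ?G ks"
  have "?P (length Cs * card D)"
    using cops_win_of_dominating[OF G dom fin(2)]
    by (intro exI[of _ "replicate (length Cs) (card D)"]) (auto simp: sum_list_replicate)
  then have "?P (LEAST k. ?P k)" by (rule LeastI)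
  then obtain ks where ks: "length ks = length Cs" "sum_list ks = multilayer_cop_number ?G" "cops_win ?G ks"
    unfolding multilayer_cop_number_def by auto
  have "K < multilayer_cop_number ?G"
  proof (rule ccontr)
    assume "\<not> ?thesis"
    then have "sum_list ks \<le> K" using ks by simp
    moreover have "evasive V (\<Union>(set Cs)) ((!) Cs) (length Cs) K" using ev Cs by simp
    moreover have "\<Union>(set Cs) \<subseteq> all_edges V" using E Cs by simp
    ultimately show False using not_cops_win_of_evasive[OF V _ _ ks(1)] ks(3) by blast
  qed
  also have "\<dots> \<le> max_cop_number V E (length Cs)"
    unfolding max_cop_number_def using G finite_layerings[OF fin(1)] by auto
  finally show ?thesis .
qed

section \<open>Product probabilities\<close>

lemma prob_pair_pmf_Times:
  "measure_pmf.prob (pair_pmf M N) (A \<times> B) = measure_pmf.prob M A * measure_pmf.prob N B"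
proof -
  \<comment> \<open>Cutting both factors down to the countable supports changes no probability and
    makes \<open>measure_pmf_prob_product\<close> applicable.\<close>
  have "measure_pmf.prob (pair_pmf M N) (A \<times> B) =
      measure_pmf.prob (pair_pmf M N) ((A \<inter> set_pmf M) \<times> (B \<inter> set_pmf N))"
    by (rule measure_pmf.finite_measure_eq_AE) (auto simp: AE_measure_pmf_iff)
  also have "\<dots> = measure_pmf.prob M (A \<inter> set_pmf M) * measure_pmf.prob N (B \<inter> set_pmf N)"
    by (rule measure_pmf_prob_product) (auto intro: countable_subset[OF _ countable_set_pmf])
  finally show ?thesis by (simp add: measure_Int_set_pmf)
qed

text \<open>Measurability with respect to the coordinates in \<open>B\<close>, stated for
  predicates; events determined on disjoint sets of coordinates are independent.\<close>

definition determined_on :: "'a set \<Rightarrow> (('a \<Rightarrow> 'b) \<Rightarrow> bool) \<Rightarrow> bool" where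
  "determined_on B P \<longleftrightarrow> (\<forall>f g. (\<forall>x\<in>B. f x = g x) \<longrightarrow> P f = P g)"

lemma determined_onD: "determined_on B P \<Longrightarrow> (\<And>x. x \<in> B \<Longrightarrow> f x = g x) \<Longrightarrow> P f = P g"
  unfolding determined_on_def by blast

text \<open>After splitting the product at \<open>B\<close>, the first factor decides
  \<open>P\<close>, and the second, whose coordinates include \<open>C\<close>, decides
  \<open>Q\<close>.\<close>

lemma prob_Pi_pmf_conj:
  assumes A: "finite A" "B \<subseteq> A" "C \<subseteq> A" "B \<inter> C = {}"
    and P: "determined_on B P" and Q: "determined_on C Q"
  shows "measure_pmf.prob (Pi_pmf A dflt q) {f. P f \<and> Q f} =
    measure_pmf.prob (Pi_pmf A dflt q) {f. P f} * measure_pmf.prob (Pi_pmf A dflt q) {f. Q f}"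
proof -
  let ?h = "\<lambda>(f, g) x. if x \<in> B then f x else g x"
  let ?M = "Pi_pmf B dflt q" and ?N = "Pi_pmf (A - B) dflt q"
  have eq: "Pi_pmf A dflt q = map_pmf ?h (pair_pmf ?M ?N)"
    using Pi_pmf_union[of B "A - B" dflt q] A
    by (simp add: Un_absorb1 finite_subset)
  have P': "P (?h (f, g)) = P f" for f g
    by (rule determined_onD[OF P]) auto
  have Q': "Q (?h (f, g)) = Q g" for f g
    by (rule determined_onD[OF Q]) (use A in auto)
  have "?h -` {f. P f \<and> Q f} = {f. P f} \<times> {g. Q g}"
    "?h -` {f. P f} = {f. P f} \<times> UNIV" "?h -` {f. Q f} = UNIV \<times> {g. Q g}"
    using P' Q' by auto
  then show ?thesis
    unfolding eq by (simp add: prob_pair_pmf_Times)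
qed

lemma prob_Pi_pmf_Ball:
  assumes A: "finite A" and U: "finite U" "\<And>u. u \<in> U \<Longrightarrow> B u \<subseteq> A"
    "\<And>u w. u \<in> U \<Longrightarrow> w \<in> U \<Longrightarrow> u \<noteq> w \<Longrightarrow> B u \<inter> B w = {}"
    and P: "\<And>u. u \<in> U \<Longrightarrow> determined_on (B u) (P u)"
  shows "measure_pmf.prob (Pi_pmf A dflt q) {f. \<forall>u\<in>U. P u f} =
    (\<Prod>u\<in>U. measure_pmf.prob (Pi_pmf A dflt q) {f. P u f})"
  using U P
proof (induction U rule: finite_induct)
  case empty
  then show ?case by simp
next
  case (insert u U)
  have det: "determined_on (\<Union>(B ` U)) (\<lambda>f. \<forall>u\<in>U. P u f)"
    using insert.prems(3) unfolding determined_on_def by (metis UN_I insertCI)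
  have "measure_pmf.prob (Pi_pmf A dflt q) {f. \<forall>u\<in>insert u U. P u f} =
      measure_pmf.prob (Pi_pmf A dflt q) {f. P u f \<and> (\<forall>u\<in>U. P u f)}" by simp
  also have "\<dots> = measure_pmf.prob (Pi_pmf A dflt q) {f. P u f} *
      measure_pmf.prob (Pi_pmf A dflt q) {f. \<forall>u\<in>U. P u f}"
  proof (rule prob_Pi_pmf_conj[OF A _ _ _ _ det])
    show "B u \<inter> \<Union>(B ` U) = {}" using insert.prems(2)[of u] insert.hyps(2) by blast
  qed (use insert.prems(1,3) in auto)
  finally show ?case using insert by simp
qed

lemma prob_Pi_pmf_in:
  assumes A: "finite A" "B \<subseteq> A"
  shows "measure_pmf.prob (Pi_pmf A dflt q) {f. \<forall>x\<in>B. f x \<in> S x} =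
    (\<Prod>x\<in>B. measure_pmf.prob (q x) (S x))"
proof -
  have "{f. \<forall>x\<in>B. f x \<in> S x} = Pi A (\<lambda>x. if x \<in> B then S x else UNIV)"
    using A by (auto simp: Pi_def)
  then have "measure_pmf.prob (Pi_pmf A dflt q) {f. \<forall>x\<in>B. f x \<in> S x} =
      (\<Prod>x\<in>A. measure_pmf.prob (q x) (if x \<in> B then S x else UNIV))"
    by (simp add: measure_Pi_pmf_Pi[OF A(1)])
  also have "\<dots> = (\<Prod>x\<in>B. measure_pmf.prob (q x) (S x))"
    by (rule prod.mono_neutral_cong_right) (use A in auto)
  finally show ?thesis .
qed

section \<open>Random layerings\<close>

text \<open>An edge with label \<open>(b, i)\<close> is present iff \<open>b\<close> holds, and then it is put into layer \<open>i\<close>.\<close>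

definition edge_label :: "real \<Rightarrow> nat \<Rightarrow> (bool \<times> nat) pmf" where
  "edge_label p \<tau> = pair_pmf (bernoulli_pmf p) (pmf_of_set {..<\<tau>})"

text \<open>The default \<open>(False, 0)\<close> is mapped by \<open>fst\<close> to the default
  \<open>False\<close> of \<open>binomial_graph\<close>, as \<open>Pi_pmf_map\<close>
  requires.\<close>

definition labelling :: "'a set \<Rightarrow> real \<Rightarrow> nat \<Rightarrow> ('a set \<Rightarrow> bool \<times> nat) pmf" where
  "labelling V p \<tau> = Pi_pmf (all_edges V) (False, 0) (\<lambda>_. edge_label p \<tau>)"

definition present_edges :: "'a set \<Rightarrow> ('a set \<Rightarrow> bool \<times> nat) \<Rightarrow> 'a set set" where
  "present_edges V f = {e \<in> all_edges V. fst (f e)}"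

definition layer_edges :: "'a set \<Rightarrow> ('a set \<Rightarrow> bool \<times> nat) \<Rightarrow> nat \<Rightarrow> 'a set set" where
  "layer_edges V f i = {e \<in> all_edges V. f e = (True, i)}"

text \<open>Absent edges receive a layer index too, so forgetting the indices is a coordinatewise
  map of a product. This transfers events about random layerings to the random graph.\<close>

lemma binomial_graph_eq_labelling:
  "binomial_graph n p = map_pmf (present_edges {..<n}) (labelling {..<n} p \<tau>)"
proof -
  have fin: "finite (all_edges {..<n})" by (simp add: finite_all_edges)
  have "bernoulli_pmf p = map_pmf fst (edge_label p \<tau>)"
    by (simp add: edge_label_def map_fst_pair_pmf)
  then have "Pi_pmf (all_edges {..<n}) False (\<lambda>_. bernoulli_pmf p) =
      map_pmf (\<lambda>h. fst \<circ> h) (labelling {..<n} p \<tau>)"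
    unfolding labelling_def by (simp add: Pi_pmf_map[OF fin, where dflt = "(False, 0)"])
  then show ?thesis
    unfolding binomial_graph_def by (simp add: map_pmf_comp present_edges_def[abs_def])
qed

lemma prob_edge_label:
  assumes p: "0 \<le> p" "p \<le> 1" and \<tau>: "0 < \<tau>" and I: "I \<subseteq> {..<\<tau>}"
  shows "measure_pmf.prob (edge_label p \<tau>) ({True} \<times> I) = p * (real (card I) / real \<tau>)"
proof -
  have "measure_pmf.prob (bernoulli_pmf p) {True} = p"
    using p by (simp add: measure_pmf_single)
  moreover have "measure_pmf.prob (pmf_of_set {..<\<tau>}) I = real (card I) / real \<tau>"
    using I \<tau> by (subst measure_pmf_of_set) (auto simp: Int_absorb1)
  ultimately show ?thesis
    unfolding edge_label_def prob_pair_pmf_Times by simp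
qed

lemma prob_edge_label_compl:
  assumes p: "0 \<le> p" "p \<le> 1" and \<tau>: "0 < \<tau>" and I: "I \<subseteq> {..<\<tau>}"
  shows "measure_pmf.prob (edge_label p \<tau>) (- ({True} \<times> I)) = 1 - p * (real (card I) / real \<tau>)"
  using measure_pmf.prob_compl[of "{True} \<times> I" "edge_label p \<tau>"]
  by (simp add: prob_edge_label[OF assms] Compl_eq_Diff_UNIV)

lemma prob_edge_label_present:
  assumes p: "0 \<le> p" "p \<le> 1"
  shows "measure_pmf.prob (edge_label p \<tau>) ({True} \<times> UNIV) = p"
  unfolding edge_label_def prob_pair_pmf_Times using p by (simp add: measure_pmf_single)

section \<open>Small dominating sets\<close>

text \<open>Averaging: if \<open>U\<close> is still uncovered, at least
  \<open>\<delta> * card U * card V\<close> pairs from \<open>V \<times> U\<close> are edges, so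
  some vertex of \<open>V\<close> covers a fraction \<open>\<delta>\<close> of \<open>U\<close>.
  Each pick thus shrinks \<open>U\<close> by the factor \<open>1 - \<delta>\<close>.\<close>

lemma exists_partially_dominating:
  fixes \<delta> :: real
  assumes V: "finite V" "V \<noteq> {}" and \<delta>: "\<delta> \<le> 1"
    and deg: "\<And>v. v \<in> V \<Longrightarrow> \<delta> * real (card V) \<le> real (card {u\<in>V. {u, v} \<in> E})"
  shows "\<exists>D\<subseteq>V. card D \<le> m \<and> real (card {v\<in>V. \<forall>d\<in>D. {d, v} \<notin> E}) \<le> (1 - \<delta>) ^ m * real (card V)"
proof (induction m)
  case 0
  show ?case by (intro exI[of _ "{}"]) auto
next
  case (Suc m)
  then obtain D where D: "D \<subseteq> V" "card D \<le> m"
    and le: "real (card {v\<in>V. \<forall>d\<in>D. {d, v} \<notin> E}) \<le> (1 - \<delta>) ^ m * real (card V)" by blast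
  define U where "U = {v\<in>V. \<forall>d\<in>D. {d, v} \<notin> E}"
  have U: "finite U" "U \<subseteq> V" using V by (auto simp: U_def)
  obtain u where u: "u \<in> V" "\<delta> * real (card U) \<le> real (card {v\<in>U. {u, v} \<in> E})"
  proof (rule ccontr)
    assume "\<not> thesis"
    then have lt: "real (card {v\<in>U. {u, v} \<in> E}) < \<delta> * real (card U)" if "u \<in> V" for u
      using that \<open>\<And>u. u \<in> V \<Longrightarrow> \<delta> * real (card U) \<le> real (card {v\<in>U. {u, v} \<in> E}) \<Longrightarrow> thesis\<close>
      by (meson not_le)
    have "(\<Sum>u\<in>V. card {v\<in>U. {u, v} \<in> E}) = (\<Sum>v\<in>U. card {u\<in>V. {u, v} \<in> E})"
      by (rule sum_multicount_gen) (use V U in auto)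
    then have "(\<Sum>u\<in>V. real (card {v\<in>U. {u, v} \<in> E})) = (\<Sum>v\<in>U. real (card {u\<in>V. {u, v} \<in> E}))"
      by (simp flip: of_nat_sum)
    also have "\<dots> \<ge> (\<Sum>v\<in>U. \<delta> * real (card V))"
      by (rule sum_mono) (use deg U in auto)
    finally have "real (card U) * (\<delta> * real (card V)) \<le> (\<Sum>u\<in>V. real (card {v\<in>U. {u, v} \<in> E}))"
      by simp
    also have "\<dots> < (\<Sum>u\<in>V. \<delta> * real (card U))"
      by (rule sum_strict_mono) (use V lt in auto)
    finally show False by (simp add: mult_ac)
  qed
  have "{v\<in>V. \<forall>d\<in>insert u D. {d, v} \<notin> E} = U - {v\<in>U. {u, v} \<in> E}" by (auto simp: U_def)
  then have "card {v\<in>V. \<forall>d\<in>insert u D. {d, v} \<notin> E} = card U - card {v\<in>U. {u, v} \<in> E}"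
    using U by (simp add: card_Diff_subset)
  moreover have "card {v\<in>U. {u, v} \<in> E} \<le> card U" using U by (intro card_mono) auto
  ultimately have "real (card {v\<in>V. \<forall>d\<in>insert u D. {d, v} \<notin> E}) \<le> (1 - \<delta>) * real (card U)"
    using u(2) by (simp add: of_nat_diff algebra_simps)
  also have "\<dots> \<le> (1 - \<delta>) * ((1 - \<delta>) ^ m * real (card V))"
    using le \<delta> by (intro mult_left_mono) (auto simp: U_def)
  finally have "real (card {v\<in>V. \<forall>d\<in>insert u D. {d, v} \<notin> E}) \<le> (1 - \<delta>) ^ Suc m * real (card V)" by simp
  moreover have "card (insert u D) \<le> Suc m"
    using D finite_subset[OF D(1) V(1)] by (simp add: card_insert_if)
  ultimately show ?case using D u(1) by (intro exI[of _ "insert u D"]) auto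
qed

lemma exists_dominating:
  fixes \<delta> :: real
  assumes V: "finite V" "V \<noteq> {}" and \<delta>: "\<delta> \<le> 1"
    and deg: "\<And>v. v \<in> V \<Longrightarrow> \<delta> * real (card V) \<le> real (card {u\<in>V. {u, v} \<in> E})"
    and m: "(1 - \<delta>) ^ m * real (card V) < 1"
  obtains D where "dominating V E D" "card D \<le> m"
proof -
  obtain D where D: "D \<subseteq> V" "card D \<le> m"
    and le: "real (card {v\<in>V. \<forall>d\<in>D. {d, v} \<notin> E}) \<le> (1 - \<delta>) ^ m * real (card V)"
    using exists_partially_dominating[OF V \<delta> deg] by blast
  then have "card {v\<in>V. \<forall>d\<in>D. {d, v} \<notin> E} = 0" using m by linarith
  then have "{v\<in>V. \<forall>d\<in>D. {d, v} \<notin> E} = {}" using V by simp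
  then have "dominating V E D" using D by (auto simp: dominating_def)
  then show ?thesis using that D by blast
qed

section \<open>Degrees\<close>

lemma integrable_edge_label:
  fixes g :: "bool \<Rightarrow> real"
  shows "integrable (measure_pmf (edge_label p \<tau>)) (\<lambda>x. g (fst x))"
proof (rule measure_pmf.integrable_const_bound)
  have "norm (g (fst x)) \<le> \<bar>g True\<bar> + \<bar>g False\<bar>" for x :: "bool \<times> nat"
    by (cases "fst x") auto
  then show "AE x in measure_pmf (edge_label p \<tau>). norm (g (fst x)) \<le> \<bar>g True\<bar> + \<bar>g False\<bar>"
    by simp
qed simp

lemma expectation_edge_label:
  fixes g :: "bool \<Rightarrow> real"
  assumes "0 \<le> p" "p \<le> 1"
  shows "measure_pmf.expectation (edge_label p \<tau>) (\<lambda>x. g (fst x)) = p * g True + (1 - p) * g False"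
proof -
  have "measure_pmf.expectation (map_pmf fst (edge_label p \<tau>)) g =
      measure_pmf.expectation (edge_label p \<tau>) (\<lambda>x. g (fst x))" by (rule integral_map_pmf)
  moreover have "map_pmf fst (edge_label p \<tau>) = bernoulli_pmf p"
    by (simp add: edge_label_def map_fst_pair_pmf)
  ultimately show ?thesis using assms by (simp add: mult.commute)
qed

lemma doubleton_in_all_edges: "{u, v} \<in> all_edges V \<longleftrightarrow> u \<in> V \<and> v \<in> V \<and> u \<noteq> v"
  by (cases "u = v") (auto simp: all_edges_def)

text \<open>The proof is Markov's inequality for \<open>exp (- degree)\<close>.\<close>

lemma prob_degree_less:
  assumes V: "finite V" "v \<in> V" and p: "0 \<le> p" "p \<le> 1"
  shows "measure_pmf.prob (labelling V p \<tau>) {f. real (card {u\<in>V. {u, v} \<in> present_edges V f}) < x}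
    \<le> exp (x - p * real (card V - 1) / 2)"
proof -
  let ?M = "labelling V p \<tau>"
  define S where "S = (\<lambda>u. {u, v}) ` (V - {v})"
  define d where "d f = card {u\<in>V. {u, v} \<in> present_edges V f}" for f :: "'a set \<Rightarrow> bool \<times> nat"
  define g where "g b = (if b then exp (-1) else (1::real))" for b
  \<comment> \<open>The factor 1 off \<open>S\<close> turns the product over the edges at
    \<open>v\<close> into one over all edges, whose expectation factorises.\<close>
  define h where "h e x = (if e \<in> S then g (fst x) else 1)" for e and x :: "bool \<times> nat"
  have inj: "inj_on (\<lambda>u. {u, v}) (V - {v})" by (auto simp: inj_on_def doubleton_eq_iff)
  have S: "S \<subseteq> all_edges V" "card S = card V - 1" "finite S"
    using V inj by (auto simp: S_def doubleton_in_all_edges card_image)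
  have fin: "finite (all_edges V)" using V by (simp add: finite_all_edges)
  have exp_d: "exp (- real (d f)) = (\<Prod>e\<in>all_edges V. h e (f e))" for f
  proof -
    have "(\<Prod>e\<in>all_edges V. h e (f e)) = (\<Prod>e\<in>S. g (fst (f e)))"
      by (rule prod.mono_neutral_cong_right) (use S fin in \<open>auto simp: h_def\<close>)
    also have "\<dots> = (\<Prod>u\<in>V - {v}. g (fst (f {u, v})))"
      unfolding S_def by (simp add: prod.reindex[OF inj])
    also have "\<dots> = (\<Prod>u\<in>{u\<in>V. {u, v} \<in> present_edges V f}. exp (-1))"
      by (rule prod.mono_neutral_cong_right)
        (use V in \<open>auto simp: g_def present_edges_def doubleton_in_all_edges\<close>)
    also have "\<dots> = exp (- real (d f))" by (simp add: d_def exp_of_nat_mult[symmetric])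
    finally show ?thesis ..
  qed
  have gpos: "0 \<le> g b" for b by (simp add: g_def)
  have intg: "integrable (measure_pmf (edge_label p \<tau>)) (h e)" for e
    using integrable_edge_label[of p \<tau> g] by (cases "e \<in> S") (auto simp: h_def[abs_def])
  have E1: "measure_pmf.expectation (edge_label p \<tau>) (\<lambda>x. g (fst x)) \<le> exp (- p / 2)"
  proof -
    \<comment> \<open>This is the origin of the \<open>/ 2\<close> in the exponent: each edge
      contributes at most \<open>1 - p / 2 \<le> exp (- p / 2)\<close>.\<close>
    have "exp (-1::real) \<le> 1 / 2"
      using exp_ge_add_one_self[of "1::real"] by (simp add: exp_minus field_simps)
    then have "p * exp (-1) + (1 - p) \<le> 1 - p / 2"
      using mult_left_mono[OF _ p(1), of "exp (-1)" "1/2"] by simp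
    also have "\<dots> \<le> exp (- p / 2)" using exp_ge_add_one_self[of "- p / 2"] by simp
    finally show ?thesis unfolding expectation_edge_label[OF p] by (simp add: g_def)
  qed
  have "measure_pmf.expectation ?M (\<lambda>f. exp (- real (d f))) =
      (\<Prod>e\<in>all_edges V. measure_pmf.expectation (edge_label p \<tau>) (h e))"
    unfolding exp_d labelling_def
    by (rule expectation_prod_Pi_pmf[OF fin intg]) (simp add: h_def gpos)
  also have "\<dots> = (\<Prod>e\<in>S. measure_pmf.expectation (edge_label p \<tau>) (\<lambda>x. g (fst x)))"
    by (rule prod.mono_neutral_cong_right) (use S fin in \<open>auto simp: h_def[abs_def]\<close>)
  also have "\<dots> \<le> exp (- p / 2) ^ card S"
    unfolding prod_constant by (intro power_mono E1 Bochner_Integration.integral_nonneg gpos)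
  also have "\<dots> = exp (- (p * real (card V - 1) / 2))"
    by (simp add: exp_of_nat_mult[symmetric] S mult.commute)
  finally have E: "measure_pmf.expectation ?M (\<lambda>f. exp (- real (d f))) \<le> exp (- (p * real (card V - 1) / 2))" .
  have "measure_pmf.prob ?M {f. real (d f) < x} \<le> measure_pmf.prob ?M {f \<in> space ?M. exp (- real (d f)) \<ge> exp (- x)}"
    by (intro measure_pmf.finite_measure_mono) auto
  also have "\<dots> \<le> measure_pmf.expectation ?M (\<lambda>f. exp (- real (d f))) / exp (- x)"
    by (rule integral_Markov_inequality_measure[where A = "{}"])
      (auto intro!: measure_pmf.integrable_const_bound[where B = 1])
  also have "\<dots> \<le> exp (- (p * real (card V - 1) / 2)) / exp (- x)"
    by (intro divide_right_mono E) auto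
  also have "\<dots> = exp (x - p * real (card V - 1) / 2)"
    by (simp flip: exp_diff)
  finally show ?thesis unfolding d_def .
qed

section \<open>Connectivity of the layers\<close>

definition cut_edges :: "'a set \<Rightarrow> 'a set \<Rightarrow> 'a set set" where
  "cut_edges V S = (\<lambda>(x, y). {x, y}) ` (S \<times> (V - S))"

lemma cut_edges_subset: "S \<subseteq> V \<Longrightarrow> cut_edges V S \<subseteq> all_edges V"
  by (auto simp: cut_edges_def doubleton_in_all_edges)

lemma card_cut_edges:
  assumes "finite V" "S \<subseteq> V"
  shows "card (cut_edges V S) = card S * (card V - card S)"
proof -
  have "inj_on (\<lambda>(x, y). {x, y}) (S \<times> (V - S))"
    by (auto simp: inj_on_def doubleton_eq_iff)
  then show ?thesis
    unfolding cut_edges_def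
    using assms by (simp add: card_image card_cartesian_product card_Diff_subset finite_subset)
qed

text \<open>The set reachable from \<open>u\<close> and its complement form a cut without edges, and
  one of them has at most half of the vertices. Restricting to that side guarantees at least
  \<open>card S * card V / 2\<close> cut edges.\<close>

lemma connected_graph_of_cuts:
  assumes V: "finite V" and C: "C \<subseteq> all_edges V"
    and cut: "\<And>S. S \<subseteq> V \<Longrightarrow> S \<noteq> {} \<Longrightarrow> 2 * card S \<le> card V \<Longrightarrow> cut_edges V S \<inter> C \<noteq> {}"
  shows "connected_graph V C"
  unfolding connected_graph_def
proof (intro ballI, rule ccontr)
  let ?R = "{(x, y). {x, y} \<in> C}\<^sup>*"
  fix u v assume uv: "u \<in> V" "v \<in> V" "(u, v) \<notin> ?R"
  define S where "S = {w\<in>V. (u, w) \<in> ?R}"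
  have S: "S \<subseteq> V" "u \<in> S" "v \<in> V - S" using uv by (auto simp: S_def)
  have closed: "{x, y} \<notin> C" if "x \<in> S" "y \<in> V - S" for x y
  proof
    assume "{x, y} \<in> C"
    then have "(u, y) \<in> ?R" using that(1) unfolding S_def
      by (auto intro: rtrancl.rtrancl_into_rtrancl)
    then show False using that(2) by (auto simp: S_def)
  qed
  have "card S + card (V - S) = card V"
    using S V by (metis card_Diff_subset card_mono finite_subset le_add_diff_inverse)
  then consider "2 * card S \<le> card V" | "2 * card (V - S) \<le> card V" by linarith
  then show False
  proof cases
    case 1
    then have "cut_edges V S \<inter> C \<noteq> {}" using S by (intro cut) auto
    then show False using closed by (auto simp: cut_edges_def)
  next
    case 2
    then have "cut_edges V (V - S) \<inter> C \<noteq> {}" using S by (intro cut) auto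
    then obtain x y where "x \<in> V - S" "y \<in> S" "{x, y} \<in> C" using S by (auto simp: cut_edges_def)
    then show False using closed[of y x] by (simp add: insert_commute)
  qed
qed

text \<open>The binomial theorem in subset form; it sums the union bound over all cuts.\<close>

lemma sum_power_card_Pow:
  fixes x :: "'b :: comm_semiring_1"
  assumes "finite A"
  shows "(\<Sum>S\<in>Pow A. x ^ card S) = (1 + x) ^ card A"
  using prod_add[OF assms, of "\<lambda>_. x" "\<lambda>_. 1"] by (simp add: add.commute)

text \<open>Each edge misses layer \<open>i\<close> with probability \<open>1 - p / \<tau>\<close>,
  so a cut with smaller side \<open>S\<close> is empty with probability at most
  \<open>x ^ card S\<close>. Summing over all nonempty \<open>S\<close>, of any size, gives
  \<open>(1 + x) ^ card V - 1\<close>.\<close>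

lemma prob_layer_disconnected:
  assumes V: "finite V" and p: "0 \<le> p" "p \<le> 1" and i: "i < \<tau>"
  shows "measure_pmf.prob (labelling V p \<tau>) {f. \<not> connected_graph V (layer_edges V f i)}
    \<le> (1 + exp (- (p / real \<tau>) * real (card V) / 2)) ^ card V - 1"
proof -
  let ?M = "labelling V p \<tau>"
  define x where "x = exp (- (p / real \<tau>) * real (card V) / 2)"
  define \<S> where "\<S> = {S. S \<subseteq> V \<and> S \<noteq> {} \<and> 2 * card S \<le> card V}"
  define bad where "bad S = {f. \<forall>e\<in>cut_edges V S. f e \<in> - ({True} \<times> {i})}" for S :: "'a set"
  have fin: "finite \<S>" using V by (auto simp: \<S>_def)
  have q: "0 \<le> p / real \<tau>" "p / real \<tau> \<le> 1"
    using p i by (auto simp: divide_simps)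
  have edge: "measure_pmf.prob (edge_label p \<tau>) (- {(True, i)}) = 1 - p / real \<tau>"
    using prob_edge_label_compl[OF p, of \<tau> "{i}"] i by auto
  have one: "measure_pmf.prob ?M (bad S) \<le> x ^ card S" if S: "S \<in> \<S>" for S
  proof -
    have SV: "S \<subseteq> V" "2 * card S \<le> card V" using S by (auto simp: \<S>_def)
    have "measure_pmf.prob ?M (bad S) = (1 - p / real \<tau>) ^ card (cut_edges V S)"
      unfolding bad_def labelling_def
      by (subst prob_Pi_pmf_in[OF finite_all_edges[OF V] cut_edges_subset[OF SV(1)]])
        (use edge in simp)
    also have "\<dots> \<le> exp (- (p / real \<tau>)) ^ card (cut_edges V S)"
      using exp_ge_add_one_self[of "- (p / real \<tau>)"] q by (intro power_mono) auto
    also have "\<dots> \<le> exp (- (p / real \<tau>) * (real (card S) * (real (card V) / 2)))"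
    proof -
      have "real (card V) / 2 \<le> real (card V - card S)" using SV by linarith
      then have "real (card S) * (real (card V) / 2) \<le> real (card (cut_edges V S))"
        unfolding card_cut_edges[OF V SV(1)] of_nat_mult by (intro mult_left_mono) auto
      then have "p / real \<tau> * (real (card S) * (real (card V) / 2)) \<le> p / real \<tau> * real (card (cut_edges V S))"
        by (intro mult_left_mono q(1))
      then show ?thesis
        by (simp add: exp_of_nat_mult[symmetric] mult.commute)
    qed
    also have "\<dots> = x ^ card S" by (simp add: x_def exp_of_nat_mult[symmetric] mult_ac)
    finally show ?thesis .
  qed
  have "{f. \<not> connected_graph V (layer_edges V f i)} \<subseteq> (\<Union>S\<in>\<S>. bad S)"
  proof
    fix f assume "f \<in> {f. \<not> connected_graph V (layer_edges V f i)}"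
    then have "\<not> connected_graph V (layer_edges V f i)" by simp
    then obtain S where "S \<subseteq> V" "S \<noteq> {}" "2 * card S \<le> card V"
        and e: "cut_edges V S \<inter> layer_edges V f i = {}"
      using connected_graph_of_cuts[OF V, of "layer_edges V f i"] by (auto simp: layer_edges_def)
    moreover from this have "f \<in> bad S" using cut_edges_subset[of S V]
      by (auto simp: bad_def layer_edges_def)
    ultimately show "f \<in> (\<Union>S\<in>\<S>. bad S)" by (auto simp: \<S>_def)
  qed
  then have "measure_pmf.prob ?M {f. \<not> connected_graph V (layer_edges V f i)}
      \<le> measure_pmf.prob ?M (\<Union>S\<in>\<S>. bad S)"
    by (intro measure_pmf.finite_measure_mono) auto
  also have "\<dots> \<le> (\<Sum>S\<in>\<S>. measure_pmf.prob ?M (bad S))"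
    by (rule measure_pmf.finite_measure_subadditive_finite[OF fin]) auto
  also have "\<dots> \<le> (\<Sum>S\<in>\<S>. x ^ card S)" by (rule sum_mono[OF one])
  also have "\<dots> \<le> (\<Sum>S\<in>Pow V - {{}}. x ^ card S)"
    by (rule sum_mono2) (use V in \<open>auto simp: \<S>_def x_def\<close>)
  also have "\<dots> = (1 + x) ^ card V - 1"
    using V by (simp add: sum_diff1 sum_power_card_Pow)
  finally show ?thesis unfolding x_def .
qed

section \<open>Escaping the cops\<close>

lemma prob_Pi_pmf_in_indexed:
  assumes A: "finite A" "g ` J \<subseteq> A" and g: "inj_on g J"
  shows "measure_pmf.prob (Pi_pmf A dflt q) {f. \<forall>j\<in>J. f (g j) \<in> S j} =
    (\<Prod>j\<in>J. measure_pmf.prob (q (g j)) (S j))"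
proof -
  have "{f. \<forall>j\<in>J. f (g j) \<in> S j} = {f. \<forall>e\<in>g ` J. f e \<in> S (inv_into J g e)}"
    using g by auto
  then show ?thesis
    using prob_Pi_pmf_in[OF A, of dflt q "\<lambda>e. S (inv_into J g e)"] g
    by (simp add: prod.reindex)
qed

text \<open>Origin of the factor 2 in the escape exponent and of the condition
  \<open>p \<le> 1 / 2\<close>.\<close>

lemma exp_minus_double_le:
  fixes y :: real
  assumes "0 \<le> y" "y \<le> 1 / 2"
  shows "exp (- 2 * y) \<le> 1 - y"
proof -
  have "2 * y\<^sup>2 \<le> y" using mult_left_mono[OF assms(2,1)] by (simp add: power2_eq_square)
  then have "- 2 * y \<le> ln (1 - y)" using ln_one_minus_pos_lower_bound[OF assms] by linarith
  then show ?thesis using assms by (subst (asm) ln_ge_iff) auto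
qed

text \<open>Whether \<open>u\<close> is an escape depends only on the edges from \<open>u\<close> to
  \<open>v\<close> and to the cops' vertices. For distinct candidates these stars are disjoint, so
  all candidates fail independently.\<close>

lemma prob_no_escape:
  assumes V: "finite V" "v \<in> V" and p: "0 \<le> p" "p \<le> 1 / 2" and \<tau>: "0 < \<tau>"
    and D: "D \<subseteq> V \<times> {..<\<tau>}" "card D \<le> K" "v \<notin> fst ` D"
  shows "measure_pmf.prob (labelling V p \<tau>)
      {f. \<not> (\<exists>u. escape_move (present_edges V f) (layer_edges V f) v D u)}
    \<le> exp (- (real (card V - Suc K) * (p * exp (- 2 * (p * real K / real \<tau>)))))"
proof -
  let ?A = "all_edges V" and ?M = "labelling V p \<tau>"
  define W where "W = fst ` D"
  \<comment> \<open>Excluding \<open>v\<close> and all cop vertices is what makes the stars at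
    distinct candidates disjoint.\<close>
  define U where "U = V - insert v W"
  define layers where "layers w = {i. (w, i) \<in> D}" for w
  \<comment> \<open>Permitted labels of the edge \<open>{w, u}\<close>: at the robber's vertex it is
    present in any layer, at a cop's vertex it avoids the layers of the cops standing there.\<close>
  define S where "S w = (if w = v then {True} \<times> UNIV else - ({True} \<times> layers w))" for w
  define P where "P u f \<longleftrightarrow> (\<forall>w\<in>insert v W. f {w, u} \<in> S w)" for u and f :: "'a set \<Rightarrow> bool \<times> nat"
  define s where "s = p * exp (- 2 * (p * real K / real \<tau>))"
  have fin: "finite ?A" "finite D" "finite W" "finite U"
    using V D finite_subset[OF D(1)] by (auto simp: finite_all_edges W_def U_def)
  have vW: "v \<notin> W" "W \<subseteq> V" "v \<in> V" using D V by (auto simp: W_def)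
  have layers: "layers w \<subseteq> {..<\<tau>}" for w using D(1) by (auto simp: layers_def)
  have sub: "(\<lambda>w. {w, u}) ` insert v W \<subseteq> ?A" if "u \<in> U" for u
    using that vW by (auto simp: U_def doubleton_in_all_edges)
  have "p \<le> 1" using p by simp
  have s: "0 \<le> s" "s \<le> measure_pmf.prob ?M {f. P u f}" if u: "u \<in> U" for u
  proof -
    \<comment> \<open>Only the total number of cops enters the exponent, however they are spread
      over vertices and layers.\<close>
    have card_D: "(\<Sum>w\<in>W. card (layers w)) = card D"
    proof -
      have "D = Sigma W layers" by (force simp: W_def layers_def)
      then show ?thesis using fin layers by (simp add: finite_subset[OF layers])
    qed
    have "(\<Prod>w\<in>insert v W. measure_pmf.prob (edge_label p \<tau>) (S w)) =
        p * (\<Prod>w\<in>W. measure_pmf.prob (edge_label p \<tau>) (S w))"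
      using fin vW prob_edge_label_present[OF p(1) \<open>p \<le> 1\<close>] by (simp add: S_def)
    also have "(\<Prod>w\<in>W. measure_pmf.prob (edge_label p \<tau>) (S w)) =
        (\<Prod>w\<in>W. 1 - p * (real (card (layers w)) / real \<tau>))"
      using vW prob_edge_label_compl[OF p(1) \<open>p \<le> 1\<close> \<tau> layers]
      by (intro prod.cong) (auto simp: S_def)
    finally have prob: "measure_pmf.prob ?M {f. P u f} =
        p * (\<Prod>w\<in>W. 1 - p * (real (card (layers w)) / real \<tau>))"
      unfolding P_def labelling_def
      by (subst prob_Pi_pmf_in_indexed[OF fin(1) sub[OF u]])
        (auto simp: inj_on_def doubleton_eq_iff)
    have "exp (- 2 * (p * real K / real \<tau>)) \<le> exp (\<Sum>w\<in>W. - 2 * (p * (real (card (layers w)) / real \<tau>)))"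
    proof -
      have "(\<Sum>w\<in>W. - 2 * (p * (real (card (layers w)) / real \<tau>))) = - 2 * (p * real (card D) / real \<tau>)"
        unfolding card_D[symmetric] by (simp add: sum_distrib_left sum_divide_distrib sum_negf)
      then show ?thesis using D(2) p \<tau> by (simp add: divide_right_mono mult_left_mono)
    qed
    also have "\<dots> = (\<Prod>w\<in>W. exp (- 2 * (p * (real (card (layers w)) / real \<tau>))))"
      using fin by (simp add: exp_sum)
    also have "\<dots> \<le> (\<Prod>w\<in>W. 1 - p * (real (card (layers w)) / real \<tau>))"
    proof (intro prod_mono conjI exp_minus_double_le)
      fix w
      have "card (layers w) \<le> \<tau>" using card_mono[OF _ layers] by simp
      then have "real (card (layers w)) / real \<tau> \<le> 1" using \<tau> by simp
      then have "p * (real (card (layers w)) / real \<tau>) \<le> p * 1"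
        using p by (intro mult_left_mono) auto
      also have "p * 1 \<le> 1 / 2" using p by simp
      finally show "p * (real (card (layers w)) / real \<tau>) \<le> 1 / 2" .
    qed (use p in auto)
    finally show "s \<le> measure_pmf.prob ?M {f. P u f}"
      unfolding prob s_def using p by (intro mult_left_mono) auto
    show "0 \<le> s" using p by (simp add: s_def)
  qed
  have "{f. \<not> (\<exists>u. escape_move (present_edges V f) (layer_edges V f) v D u)} \<subseteq> {f. \<forall>u\<in>U. \<not> P u f}"
  proof clarsimp
    fix f u assume no: "\<forall>u. \<not> escape_move (present_edges V f) (layer_edges V f) v D u" and u: "u \<in> U" "P u f"
    have "{v, u} \<in> present_edges V f"
      using u sub[OF u(1)] by (auto simp: P_def S_def present_edges_def)
    moreover have "{w, u} \<notin> layer_edges V f i" if "(w, i) \<in> D" for w i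
    proof -
      have "w \<in> W" using that by (force simp: W_def)
      then have "f {w, u} \<in> - ({True} \<times> layers w)" using u vW unfolding P_def S_def by (metis insertCI)
      then show ?thesis using that by (auto simp: layer_edges_def layers_def)
    qed
    moreover have "u \<notin> fst ` D" using u by (auto simp: U_def W_def)
    ultimately have "escape_move (present_edges V f) (layer_edges V f) v D u"
      unfolding escape_move_def by blast
    then show False using no by blast
  qed
  then have "measure_pmf.prob ?M {f. \<not> (\<exists>u. escape_move (present_edges V f) (layer_edges V f) v D u)}
      \<le> measure_pmf.prob ?M {f. \<forall>u\<in>U. \<not> P u f}"
    by (intro measure_pmf.finite_measure_mono) auto
  also have "\<dots> = (\<Prod>u\<in>U. measure_pmf.prob ?M {f. \<not> P u f})"
    unfolding labelling_def
  proof (rule prob_Pi_pmf_Ball[OF fin(1,4), where B = "\<lambda>u. (\<lambda>w. {w, u}) ` insert v W"])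
    show "(\<lambda>w. {w, u}) ` insert v W \<subseteq> ?A" if "u \<in> U" for u by (rule sub[OF that])
    show "(\<lambda>w. {w, u}) ` insert v W \<inter> (\<lambda>w. {w, u'}) ` insert v W = {}"
      if "u \<in> U" "u' \<in> U" "u \<noteq> u'" for u u'
      using that by (auto simp: U_def doubleton_eq_iff)
    show "determined_on ((\<lambda>w. {w, u}) ` insert v W) (\<lambda>f. \<not> P u f)" for u
      by (auto simp: determined_on_def P_def)
  qed
  also have "\<dots> \<le> (\<Prod>u\<in>U. exp (- s))"
  proof (intro prod_mono conjI)
    fix u assume u: "u \<in> U"
    have "measure_pmf.prob ?M {f. \<not> P u f} = 1 - measure_pmf.prob ?M {f. P u f}"
      using measure_pmf.prob_compl[of "{f. P u f}" ?M] by (simp add: set_diff_eq)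
    also have "\<dots> \<le> 1 - s" using s(2)[OF u] by simp
    also have "\<dots> \<le> exp (- s)" using exp_ge_add_one_self[of "- s"] by simp
    finally show "measure_pmf.prob ?M {f. \<not> P u f} \<le> exp (- s)" .
  qed simp
  also have "\<dots> = exp (- (real (card U) * s))" by (simp add: exp_of_nat_mult[symmetric])
  also have "\<dots> \<le> exp (- (real (card V - Suc K) * s))"
  proof -
    have "card W \<le> K" using card_image_le[OF fin(2), of fst] D(2) by (simp add: W_def)
    then have "card (insert v W) \<le> Suc K" using vW fin by simp
    moreover have "card U = card V - card (insert v W)"
      unfolding U_def using vW fin by (intro card_Diff_subset) auto
    ultimately have "real (card V - Suc K) \<le> real (card U)" by simp
    moreover have "0 \<le> s" using p by (simp add: s_def)
    ultimately show ?thesis by (simp add: mult_right_mono)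
  qed
  finally show ?thesis unfolding s_def .
qed

lemma card_small_subsets_le:
  assumes "finite A" "A \<noteq> {}"
  shows "card {D. D \<subseteq> A \<and> card D \<le> K} \<le> Suc K * card A ^ K"
proof -
  have "{D. D \<subseteq> A \<and> card D \<le> K} = (\<Union>k\<in>{..K}. {D. D \<subseteq> A \<and> card D = k})" by auto
  then have "card {D. D \<subseteq> A \<and> card D \<le> K} \<le> (\<Sum>k\<le>K. card {D. D \<subseteq> A \<and> card D = k})"
    using card_UN_le[of "{..K}" "\<lambda>k. {D. D \<subseteq> A \<and> card D = k}"] by simp
  also have "\<dots> = (\<Sum>k\<le>K. card A choose k)" using n_subsets[OF assms(1)] by simp
  also have "\<dots> \<le> (\<Sum>k\<le>K. card A ^ K)"
  proof (rule sum_mono)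
    fix k assume k: "k \<in> {..K}"
    have pos: "1 \<le> card A" using assms by (simp add: Suc_le_eq card_gt_0_iff)
    have "card A choose k \<le> card A ^ k"
      by (cases "k \<le> card A") (auto simp: binomial_le_pow binomial_eq_0)
    also have "\<dots> \<le> card A ^ K" using k pos by (intro power_increasing) auto
    finally show "card A choose k \<le> card A ^ K" .
  qed
  finally show ?thesis by simp
qed

text \<open>Union bound over positions: \<open>card V\<close> places for the robber and at most
  \<open>Suc K * (card V * \<tau>) ^ K\<close> sets of cops.\<close>

lemma prob_not_evasive:
  assumes V: "finite V" "V \<noteq> {}" and p: "0 \<le> p" "p \<le> 1 / 2" and \<tau>: "0 < \<tau>"
  shows "measure_pmf.prob (labelling V p \<tau>)
      {f. \<not> evasive V (present_edges V f) (layer_edges V f) \<tau> K}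
    \<le> real (card V) * (real (Suc K) * (real (card V) * real \<tau>) ^ K) *
       exp (- (real (card V - Suc K) * (p * exp (- 2 * (p * real K / real \<tau>)))))"
proof -
  let ?M = "labelling V p \<tau>"
  define x where "x = exp (- (real (card V - Suc K) * (p * exp (- 2 * (p * real K / real \<tau>)))))"
  define \<D> where "\<D> = {D. D \<subseteq> V \<times> {..<\<tau>} \<and> card D \<le> K}"
  define I where "I = {(v, D). v \<in> V \<and> D \<in> \<D> \<and> v \<notin> fst ` D}"
  define bad where "bad c = {f. \<not> (\<exists>u. escape_move (present_edges V f) (layer_edges V f) (fst c) (snd c) u)}"
    for c :: "'a \<times> ('a \<times> nat) set"
  have fin\<D>: "finite \<D>" using V by (auto simp: \<D>_def)
  have I: "I \<subseteq> V \<times> \<D>" by (auto simp: I_def)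
  then have fin: "finite I" by (rule finite_subset) (use V fin\<D> in auto)
  have "card I \<le> card V * card \<D>"
    using card_mono[OF _ I] V fin\<D> by (simp add: card_cartesian_product)
  also have "card \<D> \<le> Suc K * (card V * \<tau>) ^ K"
    using card_small_subsets_le[of "V \<times> {..<\<tau>}" K] V \<tau>
    by (auto simp: \<D>_def card_cartesian_product)
  finally have card: "card I \<le> card V * (Suc K * (card V * \<tau>) ^ K)" by simp
  have "{f. \<not> evasive V (present_edges V f) (layer_edges V f) \<tau> K} \<subseteq> (\<Union>c\<in>I. bad c)"
  proof
    fix f assume "f \<in> {f. \<not> evasive V (present_edges V f) (layer_edges V f) \<tau> K}"
    then obtain v D where "(v, D) \<in> I"
      and "\<not> (\<exists>u. escape_move (present_edges V f) (layer_edges V f) v D u)"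
      unfolding evasive_def I_def \<D>_def by blast
    then show "f \<in> (\<Union>c\<in>I. bad c)" by (intro UN_I[of "(v, D)"]) (simp_all add: bad_def)
  qed
  then have "measure_pmf.prob ?M {f. \<not> evasive V (present_edges V f) (layer_edges V f) \<tau> K}
      \<le> measure_pmf.prob ?M (\<Union>c\<in>I. bad c)"
    by (intro measure_pmf.finite_measure_mono) auto
  also have "\<dots> \<le> (\<Sum>c\<in>I. measure_pmf.prob ?M (bad c))"
    by (rule measure_pmf.finite_measure_subadditive_finite[OF fin]) auto
  also have "\<dots> \<le> (\<Sum>c\<in>I. x)"
  proof (rule sum_mono)
    fix c assume "c \<in> I"
    then have "fst c \<in> V" "snd c \<subseteq> V \<times> {..<\<tau>}" "card (snd c) \<le> K" "fst c \<notin> fst ` snd c"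
      unfolding I_def \<D>_def by (simp_all add: case_prod_beta)
    then show "measure_pmf.prob ?M (bad c) \<le> x"
      unfolding bad_def x_def by (rule prob_no_escape[OF V(1) _ p \<tau>])
  qed
  also have "\<dots> \<le> real (card V * (Suc K * (card V * \<tau>) ^ K)) * x"
    using card by (simp add: x_def del: of_nat_mult)
  finally show ?thesis by (simp only: x_def of_nat_mult of_nat_power)
qed

section \<open>The random graph\<close>

text \<open>The support matters: there every layer index is below \<open>\<tau>\<close>, so no
  present edge falls outside the listed layers.\<close>

lemma Union_layers:
  assumes V: "finite V" and \<tau>: "0 < \<tau>" and f: "f \<in> set_pmf (labelling V p \<tau>)"
  shows "\<Union>(set (map (layer_edges V f) [0..<\<tau>])) = present_edges V f"
proof -
  have "snd (f e) < \<tau>" if "e \<in> all_edges V" for e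
  proof -
    have "f e \<in> set_pmf (edge_label p \<tau>)"
      using f that finite_all_edges[OF V] by (auto simp: labelling_def set_Pi_pmf PiE_dflt_def)
    moreover have "{..<\<tau>} \<noteq> {}" using \<tau> by auto
    ultimately show ?thesis by (auto simp: edge_label_def set_pmf_of_set)
  qed
  then have "e \<in> (\<Union>i\<in>{..<\<tau>}. layer_edges V f i)" if "e \<in> present_edges V f" for e
    using that by (intro UN_I[of "snd (f e)"]) (simp_all add: layer_edges_def present_edges_def prod_eq_iff)
  then show ?thesis
    by (auto simp: layer_edges_def present_edges_def atLeast0LessThan)
qed

text \<open>Lets \<open>layer_edges V f\<close> be replaced by list indexing, which agrees with it
  only below \<open>\<tau>\<close>.\<close>

lemma evasive_cong:
  assumes "\<And>i. i < \<tau> \<Longrightarrow> C i = C' i"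
  shows "evasive V E C \<tau> K = evasive V E C' \<tau> K"
proof -
  have "escape_move E C v D u = escape_move E C' v D u" if "D \<subseteq> V \<times> {..<\<tau>}" for v D u
    using that assms unfolding escape_move_def by fastforce
  then show ?thesis unfolding evasive_def by blast
qed

text \<open>The three error terms bound, in this order, a vertex of low degree, a disconnected
  layer, and a position without escape. Off these events both inequalities hold
  deterministically.\<close>

lemma prob_max_cop_number:
  assumes n: "0 < n" "K < n" and p: "0 \<le> p" "p \<le> 1 / 2" and \<tau>: "0 < \<tau>"
    and m: "(1 - p / 4) ^ m * real n < 1"
  shows "measure_pmf.prob (binomial_graph n p)
      {E. K < max_cop_number {..<n} E \<tau> \<and> max_cop_number {..<n} E \<tau> \<le> \<tau> * m} \<ge>
    1 - (real n * exp (p / 4 * real n - p * real (n - 1) / 2) +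
         real \<tau> * ((1 + exp (- (p / real \<tau>) * real n / 2)) ^ n - 1) +
         real n * (real (Suc K) * (real n * real \<tau>) ^ K) *
           exp (- (real (n - Suc K) * (p * exp (- 2 * (p * real K / real \<tau>))))))"
proof -
  define V where "V = {..<n}"
  let ?M = "labelling V p \<tau>"
  have V: "finite V" "V \<noteq> {}" "card V = n" using n by (auto simp: V_def)
  have "p \<le> 1" using p by simp
  define low where "low v = {f. real (card {u\<in>V. {u, v} \<in> present_edges V f}) < p / 4 * real n}" for v
  define disc where "disc i = {f. \<not> connected_graph V (layer_edges V f i)}" for i
  define caught where "caught = {f. \<not> evasive V (present_edges V f) (layer_edges V f) \<tau> K}"
  define good where "good = {E. K < max_cop_number V E \<tau> \<and> max_cop_number V E \<tau> \<le> \<tau> * m}"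
  have good: "present_edges V f \<in> good"
    if f: "f \<in> set_pmf ?M" and ok: "f \<notin> (\<Union>v\<in>V. low v) \<union> (\<Union>i\<in>{..<\<tau>}. disc i) \<union> caught" for f
  proof -
    let ?E = "present_edges V f" and ?Cs = "map (layer_edges V f) [0..<\<tau>]"
    have E: "?E \<subseteq> all_edges V" by (auto simp: present_edges_def)
    have "p / 4 * real (card V) \<le> real (card {u\<in>V. {u, v} \<in> ?E})" if "v \<in> V" for v
      using ok that by (auto simp: low_def V not_less)
    then obtain D where D: "dominating V ?E D" "card D \<le> m"
      using exists_dominating[OF V(1,2), of "p / 4" ?E m] p m V(3) by auto
    have finD: "finite D" using D(1) V(1) by (auto simp: dominating_def intro: finite_subset)
    have "max_cop_number V ?E \<tau> \<le> \<tau> * card D"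
      by (rule max_cop_number_le[OF finite_subset[OF E finite_all_edges[OF V(1)]] D(1) finD])
    also have "\<dots> \<le> \<tau> * m" using D(2) by simp
    finally have upper: "max_cop_number V ?E \<tau> \<le> \<tau> * m" .
    have "evasive V ?E (layer_edges V f) \<tau> K" using ok by (simp add: caught_def)
    then have "evasive V ?E ((!) ?Cs) (length ?Cs) K"
      using evasive_cong[of \<tau> "layer_edges V f" "(!) ?Cs" V ?E K] by simp
    moreover have "connected_graph V C" if "C \<in> set ?Cs" for C
      using that ok by (auto simp: disc_def)
    ultimately have "K < max_cop_number V ?E (length ?Cs)"
      using max_cop_number_gt[OF V(1) _ E Union_layers[OF V(1) \<tau> f] _ _ D(1)] n V by blast
    then show ?thesis using upper by (simp add: good_def)
  qed
  \<comment> \<open>\<open>good\<close> was shown on the support only, hence monotonicity up to null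
    sets.\<close>
  have "measure_pmf.prob ?M (- (present_edges V -` good)) \<le>
      measure_pmf.prob ?M ((\<Union>v\<in>V. low v) \<union> (\<Union>i\<in>{..<\<tau>}. disc i) \<union> caught)"
    by (rule measure_pmf.finite_measure_mono_AE) (use good in \<open>auto simp: AE_measure_pmf_iff\<close>)
  also have "\<dots> \<le> measure_pmf.prob ?M (\<Union>v\<in>V. low v) + measure_pmf.prob ?M (\<Union>i\<in>{..<\<tau>}. disc i)
      + measure_pmf.prob ?M caught"
    by (intro order_trans[OF measure_Un_le] add_right_mono measure_Un_le) simp_all
  also have "measure_pmf.prob ?M (\<Union>v\<in>V. low v) \<le> (\<Sum>v\<in>V. measure_pmf.prob ?M (low v))"
    by (rule measure_pmf.finite_measure_subadditive_finite[OF V(1)]) auto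
  also have "\<dots> \<le> (\<Sum>v\<in>V. exp (p / 4 * real n - p * real (n - 1) / 2))"
    unfolding low_def V(3)[symmetric]
    by (intro sum_mono prob_degree_less V(1) p(1) \<open>p \<le> 1\<close>)
  also have "\<dots> = real n * exp (p / 4 * real n - p * real (n - 1) / 2)" using V by simp
  also have "measure_pmf.prob ?M (\<Union>i\<in>{..<\<tau>}. disc i) \<le> (\<Sum>i<\<tau>. measure_pmf.prob ?M (disc i))"
    by (rule measure_pmf.finite_measure_subadditive_finite) auto
  also have "\<dots> \<le> (\<Sum>i<\<tau>. (1 + exp (- (p / real \<tau>) * real n / 2)) ^ n - 1)"
    unfolding disc_def
    using prob_layer_disconnected[OF V(1) p(1) \<open>p \<le> 1\<close>] V(3) by (intro sum_mono) auto
  also have "\<dots> = real \<tau> * ((1 + exp (- (p / real \<tau>) * real n / 2)) ^ n - 1)" by simp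
  also have "measure_pmf.prob ?M caught \<le> real n * (real (Suc K) * (real n * real \<tau>) ^ K) *
           exp (- (real (n - Suc K) * (p * exp (- 2 * (p * real K / real \<tau>)))))"
    using prob_not_evasive[OF V(1,2) p \<tau>, of K] unfolding caught_def V(3) .
  finally have *: "measure_pmf.prob ?M (- (present_edges V -` good)) \<le> 
      real n * exp (p / 4 * real n - p * real (n - 1) / 2) +
         real \<tau> * ((1 + exp (- (p / real \<tau>) * real n / 2)) ^ n - 1) +
         real n * (real (Suc K) * (real n * real \<tau>) ^ K) *
           exp (- (real (n - Suc K) * (p * exp (- 2 * (p * real K / real \<tau>)))))" by simp
  have "measure_pmf.prob (binomial_graph n p) good = measure_pmf.prob ?M (present_edges V -` good)"
    unfolding binomial_graph_eq_labelling[of n p \<tau>] V_def by simp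
  moreover have "measure_pmf.prob ?M (- (present_edges V -` good)) =
      1 - measure_pmf.prob ?M (present_edges V -` good)"
    using measure_pmf.prob_compl[of "present_edges V -` good" ?M] by (simp add: Compl_eq_Diff_UNIV)
  ultimately have "1 - (real n * exp (p / 4 * real n - p * real (n - 1) / 2) +
         real \<tau> * ((1 + exp (- (p / real \<tau>) * real n / 2)) ^ n - 1) +
         real n * (real (Suc K) * (real n * real \<tau>) ^ K) *
           exp (- (real (n - Suc K) * (p * exp (- 2 * (p * real K / real \<tau>))))))
     \<le> measure_pmf.prob (binomial_graph n p) good" using * by linarith
  then show ?thesis unfolding good_def V_def .
qed

section \<open>Asymptotics\<close>

text \<open>In order: enough candidates remain beside the cops; the escape exponent beats the count
  of positions; the three errors add up; \<open>(1 + x) ^ n - 1\<close> may be linearised;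
  logarithms are at least 1.\<close>

lemma eventually_size_conditions:
  fixes \<epsilon> :: real
  assumes "0 < \<epsilon>"
  shows "\<forall>\<^sub>F n in sequentially. sqrt (real n) * ln (real n) \<le> real n / 2 - 1"
    and "\<forall>\<^sub>F n in sequentially. (2 * (sqrt (real n) * ln (real n)) + 2) * ln (real n) + sqrt (real n)
      \<le> real n powr (1 / 2 + 4 * \<epsilon> / 5) / 2"
    and "\<forall>\<^sub>F n in sequentially. real n * exp (1 - sqrt (real n) / 4) + 2 * (real n)\<^sup>2 * exp (- sqrt (real n) / 2)
      + exp (- sqrt (real n)) \<le> exp (- sqrt (real n) / 8)"
    and "\<forall>\<^sub>F n in sequentially. real n * exp (- sqrt (real n) / 2) \<le> 1"
    and "\<forall>\<^sub>F n in sequentially. 1 \<le> ln (real n)"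
  using assms by real_asymp+

lemma degree_error_le:
  fixes p :: real
  assumes n: "0 < n" and p: "p \<le> 1" and Np: "sqrt (real n) \<le> real n * p"
  shows "real n * exp (p / 4 * real n - p * real (n - 1) / 2) \<le> real n * exp (1 - sqrt (real n) / 4)"
proof -
  have "p / 4 * real n - p * real (n - 1) / 2 = p / 2 - real n * p / 4"
    using n by (simp add: of_nat_diff field_simps)
  then show ?thesis using p Np by (intro mult_left_mono) auto
qed

lemma power_minus_one_le:
  fixes x :: real
  assumes x: "0 \<le> x" and nx: "real n * x \<le> 1"
  shows "(1 + x) ^ n - 1 \<le> 2 * (real n * x)"
proof -
  have "(1 + x) ^ n \<le> exp x ^ n" using x by (intro power_mono) (auto simp: exp_ge_add_one_self)
  also have "\<dots> = exp (real n * x)" by (simp add: exp_of_nat_mult)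
  also have "\<dots> \<le> 1 + real n * x + (real n * x)\<^sup>2" using x nx by (intro exp_bound) auto
  also have "(real n * x)\<^sup>2 \<le> real n * x"
    using mult_left_mono[OF nx, of "real n * x"] x by (simp add: power2_eq_square)
  finally show ?thesis by linarith
qed

lemma connectivity_error_le:
  fixes p t :: real
  assumes t: "0 < t" "t \<le> real n" and q: "sqrt (real n) \<le> p / t * real n"
    and small: "real n * exp (- sqrt (real n) / 2) \<le> 1"
  shows "t * ((1 + exp (- (p / t) * real n / 2)) ^ n - 1) \<le> 2 * (real n)\<^sup>2 * exp (- sqrt (real n) / 2)"
proof -
  let ?x = "exp (- sqrt (real n) / 2)"
  have "exp (- (p / t) * real n / 2) \<le> ?x" using q by simp
  then have "(1 + exp (- (p / t) * real n / 2)) ^ n - 1 \<le> (1 + ?x) ^ n - 1"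
    by (intro diff_right_mono power_mono) auto
  also have "\<dots> \<le> 2 * (real n * ?x)" using small by (intro power_minus_one_le) auto
  finally have "t * ((1 + exp (- (p / t) * real n / 2)) ^ n - 1) \<le> t * (2 * (real n * ?x))"
    using t by (intro mult_left_mono) auto
  also have "\<dots> \<le> real n * (2 * (real n * ?x))" using t by (intro mult_right_mono) auto
  finally show ?thesis by (simp add: power2_eq_square mult_ac)
qed

text \<open>The logarithm of the number of positions is at most
  \<open>(2 * sqrt n * ln n + 2) * ln n\<close>, of order \<open>sqrt n\<close> up to logarithms,
  and the failure exponent has a strictly larger power of \<open>n\<close>.\<close>

lemma evasion_error_le:
  fixes p t \<epsilon> :: real
  assumes n: "0 < n" and K: "real K \<le> sqrt (real n) * ln (real n)"
    and Kp: "p * real K / t \<le> \<epsilon> / 10 * ln (real n)"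
    and t: "0 < t" "t \<le> real n" and p: "0 \<le> p" and Np: "real n powr (1 / 2 + \<epsilon>) \<le> real n * p"
    and ln: "0 \<le> ln (real n)"
    and large: "sqrt (real n) * ln (real n) \<le> real n / 2 - 1"
      "(2 * (sqrt (real n) * ln (real n)) + 2) * ln (real n) + sqrt (real n) \<le> real n powr (1 / 2 + 4 * \<epsilon> / 5) / 2"
  shows "real n * (real (Suc K) * (real n * t) ^ K) * exp (- (real (n - Suc K) * (p * exp (- 2 * (p * real K / t)))))
    \<le> exp (- sqrt (real n))"
proof -
  define N where "N = real n"
  have N: "0 < N" using n by (simp add: N_def)
  \<comment> \<open>Used twice: \<open>Suc K \<le> N\<close> in the count, and at least
    \<open>N / 2\<close> candidates in the exponent.\<close>
  have KN: "real K + 1 \<le> N / 2" using K large(1) by (simp add: N_def)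
  have "real (Suc K) * (N * t) ^ K \<le> N * (N * N) ^ K"
    using KN N t by (intro mult_mono power_mono) (auto simp: N_def)
  then have "N * (real (Suc K) * (N * t) ^ K) \<le> N * (N * (N * N) ^ K)"
    using N by (intro mult_left_mono) auto
  also have "\<dots> = exp ((2 * real K + 2) * ln N)"
  proof -
    have "N * (N * (N * N) ^ K) = N ^ (2 * K + 2)"
      by (simp add: mult_2_right power_add power_mult_distrib mult_ac)
    also have "\<dots> = exp (real (2 * K + 2) * ln N)" using N by (simp only: exp_of_nat_mult exp_ln)
    finally show ?thesis by simp
  qed
  also have "\<dots> \<le> exp ((2 * (sqrt N * ln N) + 2) * ln N)"
    using K ln by (simp add: N_def mult_right_mono)
  finally have count: "N * (real (Suc K) * (N * t) ^ K) \<le> exp ((2 * (sqrt N * ln N) + 2) * ln N)" .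
  \<comment> \<open>The \<open>4 / 5\<close> is \<open>1 - 2 / 10\<close>: the cops cost \<open>exp
    (- 2 * (\<epsilon> / 10 * ln N)) = N powr (- \<epsilon> / 5)\<close>.\<close>
  have "N powr (1 / 2 + 4 * \<epsilon> / 5) / 2 = N powr (1 / 2 + \<epsilon>) * N powr (- \<epsilon> / 5) / 2"
    by (simp add: add.commute flip: powr_add)
  also have "\<dots> \<le> (N * p) * N powr (- \<epsilon> / 5) / 2"
    using Np by (intro divide_right_mono mult_right_mono) (auto simp: N_def)
  also have "N powr (- \<epsilon> / 5) = exp (- 2 * (\<epsilon> / 10 * ln N))" using N by (simp add: powr_def)
  also have "(N * p) * exp (- 2 * (\<epsilon> / 10 * ln N)) / 2 \<le> (N * p) * exp (- 2 * (p * real K / t)) / 2"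
  proof (intro divide_right_mono mult_left_mono)
    have "- 2 * (\<epsilon> / 10 * ln N) \<le> - 2 * (p * real K / t)" using Kp unfolding N_def by linarith
    then show "exp (- 2 * (\<epsilon> / 10 * ln N)) \<le> exp (- 2 * (p * real K / t))" by (simp only: exp_le_cancel_iff)
  qed (use p N in auto)
  also have "\<dots> = N / 2 * (p * exp (- 2 * (p * real K / t)))" by simp
  also have "\<dots> \<le> real (n - Suc K) * (p * exp (- 2 * (p * real K / t)))"
    using KN p by (intro mult_right_mono) (auto simp: N_def)
  finally have "(2 * (sqrt N * ln N) + 2) * ln N + sqrt N \<le> real (n - Suc K) * (p * exp (- 2 * (p * real K / t)))"
    using large(2) by (simp add: N_def)
  then have "exp (- (real (n - Suc K) * (p * exp (- 2 * (p * real K / t)))))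
      \<le> exp (- sqrt N - (2 * (sqrt N * ln N) + 2) * ln N)" by simp
  with count have "N * (real (Suc K) * (N * t) ^ K) * exp (- (real (n - Suc K) * (p * exp (- 2 * (p * real K / t)))))
      \<le> exp ((2 * (sqrt N * ln N) + 2) * ln N) * exp (- sqrt N - (2 * (sqrt N * ln N) + 2) * ln N)"
    by (intro mult_mono) auto
  also have "\<dots> = exp (- sqrt N)" by (simp flip: exp_add)
  finally show ?thesis by (simp add: N_def)
qed

theorem theorem5p9:
  fixes \<epsilon> :: real and p :: "nat \<Rightarrow> real" and \<tau> :: "nat \<Rightarrow> nat"
  assumes "\<epsilon> > 0"
    and "\<forall>n. 0 < p n \<and> p n < 1"
    and "\<forall>n. 1 \<le> \<tau> n"
    and "\<forall>\<^sub>F n in sequentially. real n * p n \<ge> real n powr (1 / 2 + \<epsilon>)"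
    and "p \<longlonglongrightarrow> 0"
    and "\<forall>\<^sub>F n in sequentially. real (\<tau> n) \<le> real n powr \<epsilon>"
  shows "\<exists>c > 0. \<exists>n\<^sub>0. \<forall>n \<ge> n\<^sub>0.
    measure_pmf.prob (binomial_graph n (p n))
      {E. \<epsilon> / 10 * (real (\<tau> n) * ln (real n) / p n) \<le> real (max_cop_number {..<n} E (\<tau> n)) \<and>
          real (max_cop_number {..<n} E (\<tau> n)) \<le> 10 * (real (\<tau> n) * ln (real n) / p n)}
      \<ge> 1 - exp (- c * sqrt (real n))"
proof -
  \<comment> \<open>The slowest error is \<open>n * exp (1 - sqrt n / 4)\<close> from the degrees;
    half of its exponent absorbs the factor \<open>n\<close> and the other terms.\<close>
  define c where "c = (1 / 8 :: real)"
  \<comment> \<open>As \<open>K n\<close> is a floor, the strict inequality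
    \<open>K n < max_cop_number\<close> gives the real lower bound.\<close>
  define K where "K n = nat \<lfloor>\<epsilon> / 10 * (real (\<tau> n) * ln (real n) / p n)\<rfloor>" for n
  \<comment> \<open>The 4 inverts the degree fraction \<open>p n / 4\<close>; the \<open>+ 1\<close>
    gives strict inequality, so that fewer than one vertex stays uncovered.\<close>
  define m where "m n = nat \<lfloor>4 * ln (real n) / p n\<rfloor> + 1" for n
  have "\<forall>\<^sub>F n in sequentially. p n < 1 / 2"
    using assms(5) by (rule order_tendstoD(2)) simp
  with eventually_size_conditions[OF assms(1)] assms(4,6)
  have "\<forall>\<^sub>F n in sequentially. measure_pmf.prob (binomial_graph n (p n))
      {E. \<epsilon> / 10 * (real (\<tau> n) * ln (real n) / p n) \<le> real (max_cop_number {..<n} E (\<tau> n)) \<and>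
          real (max_cop_number {..<n} E (\<tau> n)) \<le> 10 * (real (\<tau> n) * ln (real n) / p n)}
      \<ge> 1 - exp (- c * sqrt (real n))"
  proof eventually_elim
    case (elim n)
    define N where "N = real n"
    have L: "1 \<le> ln N" using elim by (simp add: N_def)
    have "0 < N" using L unfolding N_def by (cases "n = 0") auto
    then have N: "1 < N" using L ln_gt_zero_iff[of N] by linarith
    have n: "0 < n" using N by (simp add: N_def)
    have p: "0 < p n" "p n < 1" "p n \<le> 1 / 2" using assms(2) elim by auto
    have t: "1 \<le> real (\<tau> n)" "0 < \<tau> n" "real (\<tau> n) \<le> N powr \<epsilon>"
      using assms(3) elim by (auto simp: N_def Suc_le_eq)
    have Np: "N powr (1 / 2 + \<epsilon>) \<le> N * p n" using elim by (simp add: N_def)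
    \<comment> \<open>As \<open>p n < 1\<close>, the lower bound on \<open>N * p n\<close> forces
      \<open>\<epsilon> < 1 / 2\<close>; this makes the factor \<open>\<epsilon> / 10\<close>
      harmless when \<open>K n\<close> is bounded.\<close>
    have "N * p n < N powr 1" using mult_strict_left_mono[OF p(2), of N] N by simp
    with Np have "N powr (1 / 2 + \<epsilon>) < N powr 1" by linarith
    then have \<epsilon>: "\<epsilon> < 1 / 2" by (simp only: powr_less_cancel_iff[OF N])
    have half: "N powr (1 / 2 + \<epsilon>) = sqrt N * N powr \<epsilon>" using N by (simp add: powr_add powr_half_sqrt)
    \<comment> \<open>Source of \<open>Np_sqrt\<close> for the degrees, \<open>tp\<close> for the
      size of \<open>K n\<close>, \<open>tN\<close> for the counting, and the density
      \<open>p n / \<tau> n\<close> needed for connectivity.\<close>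
    have tau_sqrt: "real (\<tau> n) * sqrt N \<le> N * p n"
    proof -
      have "real (\<tau> n) * sqrt N \<le> N powr \<epsilon> * sqrt N" using t(3) N by (intro mult_right_mono) auto
      then show ?thesis using Np unfolding half by (simp only: mult.commute[of "sqrt N"])
    qed
    have Np_sqrt: "sqrt N \<le> N * p n"
    proof -
      have "1 * sqrt N \<le> real (\<tau> n) * sqrt N" using t(1) N by (intro mult_right_mono) auto
      then show ?thesis using tau_sqrt by linarith
    qed
    have tp: "real (\<tau> n) / p n \<le> sqrt N"
    proof -
      have "sqrt N * sqrt N = N" using N by simp
      then have "real (\<tau> n) * sqrt N \<le> (sqrt N * p n) * sqrt N"
        using tau_sqrt by (metis mult.assoc mult.commute)
      then have "real (\<tau> n) \<le> sqrt N * p n" using N by (simp only: mult_le_cancel_right_pos real_sqrt_gt_zero)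
      then show ?thesis using p by (simp add: divide_le_eq)
    qed
    have tN: "real (\<tau> n) \<le> N"
    proof -
      have "real (\<tau> n) * 1 \<le> real (\<tau> n) * sqrt N" using N by (intro mult_left_mono) auto
      also note tau_sqrt
      also have "N * p n \<le> N * 1" using p N by (intro mult_left_mono) auto
      finally show ?thesis by simp
    qed
    have pos: "0 \<le> \<epsilon> / 10 * (real (\<tau> n) * ln N / p n)"
      using assms(1) t(1) L p by simp
    have Kle: "real (K n) \<le> \<epsilon> / 10 * (real (\<tau> n) * ln N / p n)"
      using pos unfolding K_def N_def by simp
    also have "\<dots> \<le> 1 * (real (\<tau> n) * ln N / p n)"
      using \<epsilon> t(1) L p by (intro mult_right_mono) auto
    also have "\<dots> = real (\<tau> n) / p n * ln N" by simp
    also have "\<dots> \<le> sqrt N * ln N" using tp L by (intro mult_right_mono) auto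
    finally have K: "real (K n) \<le> sqrt N * ln N" .
    then have "real (K n) < N" using elim N by (simp add: N_def)
    then have Kn: "K n < n" by (simp add: N_def)
    have Kp: "p n * real (K n) / real (\<tau> n) \<le> \<epsilon> / 10 * ln N"
    proof -
      have "p n * real (K n) \<le> p n * (\<epsilon> / 10 * (real (\<tau> n) * ln N / p n))"
        using Kle p by (intro mult_left_mono) auto
      also have "\<dots> = \<epsilon> / 10 * ln N * real (\<tau> n)" using p by simp
      finally show ?thesis using t by (simp add: divide_le_eq)
    qed
    have m: "(1 - p n / 4) ^ m n * real n < 1"
    proof -
      have mgt: "4 * ln N / p n < real (m n)" unfolding m_def N_def by linarith
      have "(1 - p n / 4) ^ m n \<le> exp (- p n / 4) ^ m n"
        using p exp_ge_add_one_self[of "- p n / 4"] by (intro power_mono) auto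
      also have "\<dots> = exp (- (p n * real (m n) / 4))" by (simp add: exp_of_nat_mult[symmetric] mult.commute)
      also have "\<dots> < exp (- ln N)" using mgt p by (simp add: divide_less_eq mult.commute)
      also have "\<dots> = 1 / N" using N by (simp add: exp_minus inverse_eq_divide)
      finally show ?thesis using N by (simp add: N_def field_simps)
    qed
    \<comment> \<open>In fact \<open>m n \<le> 4 * ln N / p n + 1 \<le> 5 * (ln N / p n)\<close>, so
      10 leaves room.\<close>
    have m10: "real (\<tau> n) * real (m n) \<le> 10 * (real (\<tau> n) * ln N / p n)"
    proof -
      have "1 \<le> ln N / p n" using L p by (simp add: le_divide_eq)
      moreover have "real (m n) \<le> 4 * ln N / p n + 1"
        using L p unfolding m_def N_def by simp
      ultimately have "real (m n) \<le> 10 * (ln N / p n)" by simp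
      then have "real (\<tau> n) * real (m n) \<le> real (\<tau> n) * (10 * (ln N / p n))"
        by (intro mult_left_mono) auto
      then show ?thesis by (simp add: mult.left_commute)
    qed
    have "real n * exp (p n / 4 * real n - p n * real (n - 1) / 2) \<le> real n * exp (1 - sqrt (real n) / 4)"
      by (rule degree_error_le[OF n]) (use p Np_sqrt in \<open>simp_all add: N_def\<close>)
    moreover have "real (\<tau> n) * ((1 + exp (- (p n / real (\<tau> n)) * real n / 2)) ^ n - 1)
        \<le> 2 * (real n)\<^sup>2 * exp (- sqrt (real n) / 2)"
    proof (rule connectivity_error_le)
      show "sqrt (real n) \<le> p n / real (\<tau> n) * real n"
        using tau_sqrt t by (simp add: N_def field_simps)
    qed (use t tN elim in \<open>auto simp: N_def\<close>)
    moreover have "real n * (real (Suc (K n)) * (real n * real (\<tau> n)) ^ K n) *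
        exp (- (real (n - Suc (K n)) * (p n * exp (- 2 * (p n * real (K n) / real (\<tau> n))))))
        \<le> exp (- sqrt (real n))"
      by (rule evasion_error_le[where \<epsilon> = \<epsilon>]) (use n K Kp t tN p Np L elim in \<open>auto simp: N_def\<close>)
    moreover have "real n * exp (1 - sqrt (real n) / 4) + 2 * (real n)\<^sup>2 * exp (- sqrt (real n) / 2)
      + exp (- sqrt (real n)) \<le> exp (- c * sqrt (real n))" using elim by (simp add: c_def)
    ultimately have "1 - exp (- c * sqrt (real n)) \<le> measure_pmf.prob (binomial_graph n (p n))
      {E. K n < max_cop_number {..<n} E (\<tau> n) \<and> max_cop_number {..<n} E (\<tau> n) \<le> \<tau> n * m n}"
      using prob_max_cop_number[OF n Kn _ p(3) t(2) m] p(1) by linarith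
    also have "\<dots> \<le> measure_pmf.prob (binomial_graph n (p n))
      {E. \<epsilon> / 10 * (real (\<tau> n) * ln (real n) / p n) \<le> real (max_cop_number {..<n} E (\<tau> n)) \<and>
          real (max_cop_number {..<n} E (\<tau> n)) \<le> 10 * (real (\<tau> n) * ln (real n) / p n)}"
    proof (rule measure_pmf.finite_measure_mono; safe?)
      fix E assume "K n < max_cop_number {..<n} E (\<tau> n)"
      then show "\<epsilon> / 10 * (real (\<tau> n) * ln (real n) / p n) \<le> real (max_cop_number {..<n} E (\<tau> n))"
        unfolding K_def by linarith
    next
      fix E assume "max_cop_number {..<n} E (\<tau> n) \<le> \<tau> n * m n"
      then have "real (max_cop_number {..<n} E (\<tau> n)) \<le> real (\<tau> n) * real (m n)"
        by (simp flip: of_nat_mult)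
      then show "real (max_cop_number {..<n} E (\<tau> n)) \<le> 10 * (real (\<tau> n) * ln (real n) / p n)"
        using m10 by (simp add: N_def)
    qed simp
    finally show ?case .
  qed
  moreover have "0 < c" by (simp add: c_def)
  ultimately show ?thesis unfolding eventually_sequentially by blast
qed

end
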